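(* Let $R:=\operatorname{Vol}(\mathcal{Q}_{m,n}\cap \mathcal{D}_{m,n})/\operatorname{Vol}(\mathcal{P}_{m,n}\cap \mathcal{D}_{m,n})$. As $n\to\infty$ (with $m=m(n)\ge2$), $R$ behaves as follows. (a) If $m$ is fixed, then $R\sim \dfrac{n^{m/(m-1)}}{\Gamma\bigl(\frac{2m-1}{m-1}\bigr)^m}$. (b) If $m\sim\beta\ln n$ for a constant $\beta>0$, then $R\sim e^{\gamma-1+1/\beta}\,n$. (c) If $m/\ln n\to\infty$, then $R\sim e^{\gamma-1}\,n$.
   Context: Let $m\ge2$, $n\ge1$ be integers, $M=\{1,\dots,m\}$, $N=\{1,\dots,n\}$. The set $\mathcal{P}_{m,n}$ (strong relaxation) consists of all $(x,y)\in\mathbb{R}^{m\times n}\times\mathbb{R}^m$ with $0\le x_{ij}\le y_i$ for all $(i,j)\in M\times N$ and $y_i\le 1$ for all $i\in M$. The set $\mathcal{Q}_{m,n}$ (weak relaxation) consists of all $(x,y)\in\mathbb{R}^{m\times n}\times\mathbb{R}^m$ with $\sum_{j\in N}x_{ij}\le n y_i$ for all $i\in M$, $0\le x_{ij}\le 1$ for all $(i,j)\in M\times N$, and $y_i\le1$ for all $i\in M$. The demand constraints define $\mathcal{D}_{m,n}=\{(x,y)\in\mathbb{R}^{m\times n}\times\mathbb{R}^m:\ \sum_{i\in M}x_{ij}=1\ \ \forall j\in N\}$, an affine subspace of dimension $d=(m-1)n+m$. For $K\subset\mathcal{D}_{m,n}$, $\operatorname{Vol}(K)$ denotes the $d$-dimensional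 Lebesgue measure of the image of $K$ under the coordinate projection $\mathcal{D}_{m,n}\to\mathbb{R}^d$ that deletes the variables $x_{mj}$, $j\in N$ (an affine bijection). $\gamma$ is Euler's constant, $\Gamma$ the gamma function, $\ln$ the natural logarithm, and $a\sim b$ means $a/b\to1$. *)

theory Defs
  imports "HOL-Analysis.Analysis" "HOL-Library.Landau_Symbols"
begin

text \<open>
  Since the dimensions \<open>m\<close> and \<open>n\<close> vary together, \<open>\<real>\<^sup>I\<close> for a finite index set \<open>I\<close> is
  rendered as the set of extensional functions \<open>I \<rightarrow>\<^sub>E UNIV\<close>, which is the space of
  the product measure \<open>PiM I (\<lambda>_. lborel)\<close>.
\<close>

type_synonym point = "(nat \<times> nat \<Rightarrow> real) \<times> (nat \<Rightarrow> real)"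

definition ambient :: "nat \<Rightarrow> nat \<Rightarrow> point set" where
  "ambient m n = ({1..m} \<times> {1..n} \<rightarrow>\<^sub>E UNIV) \<times> ({1..m} \<rightarrow>\<^sub>E UNIV)"

definition strong_relaxation :: "nat \<Rightarrow> nat \<Rightarrow> point set" where
  "strong_relaxation m n = {(x, y) \<in> ambient m n.
     (\<forall>i\<in>{1..m}. \<forall>j\<in>{1..n}. 0 \<le> x (i, j) \<and> x (i, j) \<le> y i) \<and>
     (\<forall>i\<in>{1..m}. y i \<le> 1)}"

definition weak_relaxation :: "nat \<Rightarrow> nat \<Rightarrow> point set" where
  "weak_relaxation m n = {(x, y) \<in> ambient m n.
     (\<forall>i\<in>{1..m}. (\<Sum>j\<in>{1..n}. x (i, j)) \<le> real n * y i) \<and>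
     (\<forall>i\<in>{1..m}. \<forall>j\<in>{1..n}. 0 \<le> x (i, j) \<and> x (i, j) \<le> 1) \<and>
     (\<forall>i\<in>{1..m}. y i \<le> 1)}"

definition demand_space :: "nat \<Rightarrow> nat \<Rightarrow> point set" where
  "demand_space m n = {(x, y) \<in> ambient m n. \<forall>j\<in>{1..n}. (\<Sum>i\<in>{1..m}. x (i, j)) = 1}"

definition delete_last :: "nat \<Rightarrow> nat \<Rightarrow> point \<Rightarrow> point" where
  "delete_last m n = (\<lambda>(x, y). (restrict x ({1..<m} \<times> {1..n}), y))"

text \<open>
  The completion of the product of one-dimensional Lebesgue--Borel measures is Lebesgue
  measure in the \<open>(m - 1) * n + m\<close> coordinates that remain after the projection.
\<close>

definition reduced_lebesgue :: "nat \<Rightarrow> nat \<Rightarrow> point measure" where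
  "reduced_lebesgue m n = completion
     (PiM ({1..<m} \<times> {1..n}) (\<lambda>_. lborel) \<Otimes>\<^sub>M PiM {1..m} (\<lambda>_. lborel))"

text \<open>Meaningful for subsets of \<open>demand_space m n\<close>, where \<open>delete_last m n\<close> is injective.\<close>

definition Vol :: "nat \<Rightarrow> nat \<Rightarrow> point set \<Rightarrow> real" where
  "Vol m n K = measure (reduced_lebesgue m n) (delete_last m n ` K)"

definition volume_ratio :: "nat \<Rightarrow> nat \<Rightarrow> real" where
  "volume_ratio m n =
     Vol m n (weak_relaxation m n \<inter> demand_space m n) /
     Vol m n (strong_relaxation m n \<inter> demand_space m n)"

end

theory Submission
  imports Defs "HOL-Probability.Probability"
begin

text \<open>
  After integrating out \<open>y\<close>, the ratio is \<open>R = W / V\<close>, where the columns \<open>X\<^sub>1, \<dots>, X\<^sub>n\<close> are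
  independent uniform points of the standard simplex with vertices \<open>1, \<dots>, m\<close>,
  \<open>W = E (\<Prod>i. 1 - (\<Sum>j. X\<^sub>i\<^sub>j) / n)\<close> and \<open>V = E (\<Prod>i. 1 - (MAX j. X\<^sub>i\<^sub>j))\<close>.
  A variance bound gives \<open>(1 - 1/m)^m (1 - 4/n) \<le> W \<le> (1 - 1/m)^m\<close>.

  For \<open>V\<close> put \<open>a = 1/(m - 1)\<close>. The part of the simplex with \<open>x\<^sub>i \<ge> c\<close> is a copy of the simplex
  scaled by \<open>1 - c\<close>. Hence \<open>P (x\<^sub>i > c) = (1 - c)^(m - 1)\<close> for a uniform point \<open>x\<close> and its coordinates are negatively
  dependent, which gives \<open>V \<le> I^m\<close> with \<open>I = (\<integral>t\<in>{0..1}. (1 - t^(m - 1))^n) = (\<Prod>k=1..n. k / (k + a))\<close>.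
  Jensen's inequality gives \<open>V \<ge> exp (- (1 + a) H\<^sub>n)\<close> with the harmonic number \<open>H\<^sub>n\<close>; as
  \<open>m \<rightarrow> \<infinity>\<close> this matches the upper bound, and only \<open>H\<^sub>n - ln n \<rightarrow> \<gamma>\<close> is needed.
  For fixed \<open>m\<close> the union bound near \<open>y = (1, \<dots>, 1)\<close> shows \<open>V \<sim> I^m\<close>, and \<open>n^a I \<rightarrow> \<Gamma>(1 + a)\<close> by Euler's
  product.
\<close>

text \<open>The volume behind \<open>V\<close> is read in two orders. For a fixed matrix the
  admissible \<open>y\<close> form a box, which gives the expectation of the overview. For fixed
  \<open>y\<close> the columns are independent and obey the same constraint, so \<open>V\<close> is
  also the integral of F(y)^n, where F(y) is the probability that a uniform point of the simplex is
  at most \<open>y\<close> in every coordinate. Bounds on F give the upper bound \<open>I^m\<close>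
  and the lower bound for fixed \<open>m\<close>; the first order gives the Jensen bound. Two lower
  bounds are needed. The upper bound exceeds the Jensen bound by at most the factor exp (2 m a^2),
  which tends to 1 as \<open>m\<close> grows; for fixed \<open>m\<close> Jensen loses a constant
  factor, and the value of Gamma has to come from \<open>I\<close> itself. There F is compared with
  the product of its marginals near the corner y = (1, ..., 1) only. This suffices because F(y)^n is
  negligible elsewhere, and close to the corner the union bound and the product differ only to
  second order.\<close>

declare One_nat_def [simp del]

section \<open>Lebesgue measure on finite products\<close>

abbreviation lborel_on :: "'i set \<Rightarrow> ('i \<Rightarrow> real) measure" where
  "lborel_on I \<equiv> PiM I (\<lambda>_. lborel)"

lemma product_sigma_finite_lborel: "product_sigma_finite (\<lambda>_. lborel :: real measure)"
  by (simp add: product_sigma_finite_def sigma_finite_lborel)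

lemma product_sigma_finite_lborel_on:
  "finite I \<Longrightarrow> product_sigma_finite (\<lambda>_. lborel_on I)"
  using product_sigma_finite.sigma_finite[OF product_sigma_finite_lborel]
  by (simp add: product_sigma_finite_def)

lemma emeasure_lborel_affine_vimage:
  fixes s :: real
  assumes s: "s > 0" and A: "A \<in> sets lborel"
  shows "emeasure lborel A = ennreal s * emeasure lborel ((\<lambda>x. v + s * x) -` A)"
proof -
  have A': "A \<in> sets borel" using A by simp
  have "emeasure lborel A = emeasure (density (distr lborel borel (\<lambda>x. v + s * x)) (\<lambda>_. ennreal \<bar>s\<bar>)) A"
    using s by (subst lborel_real_affine[of s v]) auto
  also have "\<dots> = ennreal s * emeasure (distr lborel borel (\<lambda>x. v + s * x)) A"
    using A' s by (simp add: emeasure_density nn_integral_cmult_indicator)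
  also have "emeasure (distr lborel borel (\<lambda>x. v + s * x)) A = emeasure lborel ((\<lambda>x. v + s * x) -` A)"
    using A' by (subst emeasure_distr) auto
  finally show ?thesis .
qed

text \<open>The rescaled pushforward \<open>P\<close> has the right value on every box, so
  uniqueness of the product measure identifies it. This is the change of variables for the
  contraction of the simplex towards a vertex.\<close>

lemma emeasure_lborel_on_affine_vimage:
  fixes s :: real
  assumes I: "finite I" and s: "s > 0" and B: "B \<in> sets (lborel_on I)"
  shows "emeasure (lborel_on I) B =
    ennreal (s ^ card I) * emeasure (lborel_on I) {x \<in> space (lborel_on I). (\<lambda>k\<in>I. v k + s * x k) \<in> B}"
proof -
  interpret product_sigma_finite "\<lambda>_::'a. lborel :: real measure"
    by (rule product_sigma_finite_lborel)
  define T where "T = (\<lambda>x::'a \<Rightarrow> real. \<lambda>k\<in>I. v k + s * x k)"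
  have T[measurable]: "T \<in> measurable (lborel_on I) (lborel_on I)"
    unfolding T_def by measurable
  define P where "P = density (distr (lborel_on I) (lborel_on I) T) (\<lambda>_. ennreal (s ^ card I))"
  have P: "emeasure P A = ennreal (s ^ card I) * emeasure (lborel_on I) (T -` A \<inter> space (lborel_on I))"
    if "A \<in> sets (lborel_on I)" for A
    using that unfolding P_def
    by (simp add: emeasure_density nn_integral_cmult_indicator emeasure_distr)
  have "P = lborel_on I"
  proof (rule PiM_eqI)
    show "sets P = sets (lborel_on I)" by (simp add: P_def)
    fix A :: "'a \<Rightarrow> real set" assume A: "\<And>i. i \<in> I \<Longrightarrow> A i \<in> sets lborel"
    have "T -` Pi\<^sub>E I A \<inter> space (lborel_on I) = Pi\<^sub>E I (\<lambda>k. (\<lambda>x. v k + s * x) -` A k)"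
      by (auto simp: T_def space_PiM PiE_def Pi_def extensional_def)
    moreover have "(\<lambda>x. v k + s * x) -` A k \<in> sets lborel" if "k \<in> I" for k
    proof -
      have "(\<lambda>x. v k + s * x) \<in> borel_measurable borel" by measurable
      from measurable_sets[OF this, of "A k"] A[OF that] show ?thesis by simp
    qed
    ultimately have "emeasure P (Pi\<^sub>E I A) =
        ennreal (s ^ card I) * (\<Prod>k\<in>I. emeasure lborel ((\<lambda>x. v k + s * x) -` A k))"
      using A I by (simp add: P sets_PiM_I_finite emeasure_PiM)
    also have "\<dots> = (\<Prod>k\<in>I. ennreal s * emeasure lborel ((\<lambda>x. v k + s * x) -` A k))"
      using s by (simp add: prod.distrib ennreal_power)
    also have "\<dots> = (\<Prod>k\<in>I. emeasure lborel (A k))"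
      using emeasure_lborel_affine_vimage[OF s A] by (intro prod.cong) auto
    finally show "emeasure P (Pi\<^sub>E I A) = (\<Prod>k\<in>I. emeasure lborel (A k))" .
  qed (fact I)
  then have "emeasure (lborel_on I) B = emeasure P B" by simp
  also have "\<dots> = ennreal (s ^ card I) * emeasure (lborel_on I) (T -` B \<inter> space (lborel_on I))"
    by (rule P) fact
  also have "T -` B \<inter> space (lborel_on I) = {x \<in> space (lborel_on I). (\<lambda>k\<in>I. v k + s * x k) \<in> B}"
    by (auto simp: T_def)
  finally show ?thesis .
qed

text \<open>Currying a matrix into the family of its columns preserves measure, as is seen on boxes;
  a condition imposed on each column separately then becomes a box of columns.\<close>

lemma emeasure_lborel_on_Times_columns:
  assumes I: "finite I" and J: "finite J"
    and B: "\<And>j. j \<in> J \<Longrightarrow> B j \<in> sets (lborel_on I)"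
  shows "emeasure (lborel_on (I \<times> J))
      {x \<in> space (lborel_on (I \<times> J)). \<forall>j\<in>J. (\<lambda>i\<in>I. x (i, j)) \<in> B j} =
    (\<Prod>j\<in>J. emeasure (lborel_on I) (B j))"
proof -
  interpret L: product_sigma_finite "\<lambda>_::'a \<times> 'b. lborel :: real measure"
    by (rule product_sigma_finite_lborel)
  interpret LI: product_sigma_finite "\<lambda>_::'a. lborel :: real measure"
    by (rule product_sigma_finite_lborel)
  interpret C: product_sigma_finite "\<lambda>_::'b. lborel_on I"
    using I by (rule product_sigma_finite_lborel_on)
  let ?CC = "PiM J (\<lambda>_. lborel_on I)"
  define T where "T = (\<lambda>f::'b \<Rightarrow> 'a \<Rightarrow> real. \<lambda>ij\<in>I \<times> J. f (snd ij) (fst ij))"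
  have T[measurable]: "T \<in> measurable ?CC (lborel_on (I \<times> J))"
    unfolding T_def
  proof (rule measurable_restrict)
    fix ij assume ij: "ij \<in> I \<times> J"
    then have "(\<lambda>f. f (snd ij)) \<in> measurable ?CC (lborel_on I)"
      by (intro measurable_component_singleton) auto
    moreover have "(\<lambda>g. g (fst ij)) \<in> measurable (lborel_on I) lborel"
      using ij by (intro measurable_component_singleton) auto
    ultimately show "(\<lambda>f. f (snd ij) (fst ij)) \<in> measurable ?CC lborel"
      by (rule measurable_compose)
  qed
  have eq: "distr ?CC (lborel_on (I \<times> J)) T = lborel_on (I \<times> J)"
  proof (rule L.PiM_eqI)
    fix A :: "'a \<times> 'b \<Rightarrow> real set"
    assume A: "\<And>i. i \<in> I \<times> J \<Longrightarrow> A i \<in> sets lborel"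
    have "T -` Pi\<^sub>E (I \<times> J) A \<inter> space ?CC = Pi\<^sub>E J (\<lambda>j. Pi\<^sub>E I (\<lambda>i. A (i, j)))"
      by (auto simp: T_def space_PiM PiE_def Pi_def extensional_def)
    then show "emeasure (distr ?CC (lborel_on (I \<times> J)) T) (Pi\<^sub>E (I \<times> J) A) =
        (\<Prod>ij\<in>I \<times> J. emeasure lborel (A ij))"
      using I J A
      by (simp add: emeasure_distr sets_PiM_I_finite C.emeasure_PiM LI.emeasure_PiM
          prod.cartesian_product' prod.swap[of _ J I])
  qed (use I J in auto)
  define E where "E = {x \<in> space (lborel_on (I \<times> J)). \<forall>j\<in>J. (\<lambda>i\<in>I. x (i, j)) \<in> B j}"
  have E: "E \<in> sets (lborel_on (I \<times> J))"
  proof -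
    have "{x \<in> space (lborel_on (I \<times> J)). (\<lambda>i\<in>I. x (i, j)) \<in> B j} \<in> sets (lborel_on (I \<times> J))"
      if j: "j \<in> J" for j
    proof -
      have "(\<lambda>x. \<lambda>i\<in>I. x (i, j)) \<in> measurable (lborel_on (I \<times> J)) (lborel_on I)"
        using j by (intro measurable_restrict measurable_component_singleton) auto
      from measurable_sets[OF this B[OF j]] show ?thesis
        by (simp add: vimage_def Int_def conj_commute)
    qed
    then show ?thesis unfolding E_def using J by (intro sets.sets_Collect_finite_All) auto
  qed
  have "emeasure (lborel_on (I \<times> J)) E = emeasure ?CC (T -` E \<inter> space ?CC)"
    by (subst eq[symmetric]) (use E in \<open>simp add: emeasure_distr\<close>)
  also have "T -` E \<inter> space ?CC = Pi\<^sub>E J B"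
  proof -
    have "(\<lambda>i\<in>I. T f (i, j)) = f j" if "f \<in> space ?CC" "j \<in> J" for f j
      using that by (auto simp: T_def space_PiM PiE_def Pi_def extensional_def fun_eq_iff)
    moreover have "B j \<subseteq> space (lborel_on I)" if "j \<in> J" for j
      using B[OF that] by (rule sets.sets_into_space)
    moreover have "T f \<in> space (lborel_on (I \<times> J))" for f
      by (auto simp: T_def space_PiM)
    moreover have "Pi\<^sub>E J B = {f \<in> space ?CC. \<forall>j\<in>J. f j \<in> B j}"
    proof (intro subset_antisym subsetI)
      fix f assume f: "f \<in> Pi\<^sub>E J B"
      then have "f j \<in> space (lborel_on I)" if "j \<in> J" for j
        using calculation(2)[OF that] that by (auto simp: PiE_iff)
      with f show "f \<in> {f \<in> space ?CC. \<forall>j\<in>J. f j \<in> B j}"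
        by (simp add: space_PiM[of J] PiE_iff)
    qed (simp add: space_PiM[of J] PiE_iff)
    ultimately show ?thesis
      by (auto simp: E_def)
  qed
  also have "emeasure ?CC (Pi\<^sub>E J B) = (\<Prod>j\<in>J. emeasure (lborel_on I) (B j))"
    using J B by (simp add: C.emeasure_PiM)
  finally show ?thesis unfolding E_def .
qed

section \<open>The uniform law on the simplex\<close>

text \<open>Undoes \<open>delete_last\<close> within one column: coordinate \<open>m\<close> is
  recovered from the demand equation, so that all \<open>m\<close> coordinates can be treated
  alike.\<close>

definition bary :: "nat \<Rightarrow> (nat \<Rightarrow> real) \<Rightarrow> nat \<Rightarrow> real" where
  "bary m x = (\<lambda>i\<in>{1..m}. if i < m then x i else 1 - (\<Sum>k\<in>{1..<m}. x k))"

definition corner_simplex :: "nat \<Rightarrow> (nat \<Rightarrow> real) set" where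
  "corner_simplex m = {x \<in> space (lborel_on {1..<m}). \<forall>i\<in>{1..m}. 0 \<le> bary m x i}"

text \<open>The flat Dirichlet law. Its carrier lies in a hyperplane of the \<open>m\<close>
  coordinates, where it has no Lebesgue density, so it is defined as a pushforward from the
  \<open>m - 1\<close> free coordinates.\<close>

definition bary_law :: "nat \<Rightarrow> (nat \<Rightarrow> real) measure" where
  "bary_law m =
    distr (uniform_measure (lborel_on {1..<m}) (corner_simplex m)) (PiM {1..m} (\<lambda>_. borel)) (bary m)"

definition contraction :: "nat \<Rightarrow> nat \<Rightarrow> real \<Rightarrow> (nat \<Rightarrow> real) \<Rightarrow> nat \<Rightarrow> real" where
  "contraction m i c z = (\<lambda>k\<in>{1..m}. (if k = i then c else 0) + (1 - c) * z k)"

lemma measurable_bary [measurable]: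
  "bary m \<in> measurable (lborel_on {1..<m}) (PiM {1..m} (\<lambda>_. borel))"
  unfolding bary_def
proof (rule measurable_restrict)
  fix i assume "i \<in> {1..m}"
  have [measurable]: "(\<lambda>x. x k) \<in> borel_measurable (lborel_on {1..<m})" if "k \<in> {1..<m}" for k
    using measurable_component_singleton[OF that, of "\<lambda>_. lborel :: real measure"] by simp
  show "(\<lambda>x. if i < m then x i else 1 - (\<Sum>k\<in>{1..<m}. x k)) \<in> borel_measurable (lborel_on {1..<m})"
    using \<open>i \<in> {1..m}\<close> by (cases "i < m") auto
qed

lemma measurable_component_real:
  "i \<in> I \<Longrightarrow> (\<lambda>x. x i) \<in> borel_measurable (PiM I (\<lambda>_. borel :: real measure))"
  by (rule measurable_component_singleton)

lemma sets_corner_simplex [measurable]: "corner_simplex m \<in> sets (lborel_on {1..<m})"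
proof -
  have "{x \<in> space (lborel_on {1..<m}). 0 \<le> bary m x i} \<in> sets (lborel_on {1..<m})"
    if "i \<in> {1..m}" for i
  proof -
    have [measurable]: "(\<lambda>x. bary m x i) \<in> borel_measurable (lborel_on {1..<m})"
      using that measurable_compose[OF measurable_bary measurable_component_real] by simp
    show ?thesis by measurable
  qed
  then show ?thesis unfolding corner_simplex_def by (intro sets.sets_Collect_finite_All) auto
qed

lemma sum_bary:
  assumes "m \<ge> 1" shows "(\<Sum>i\<in>{1..m}. bary m x i) = 1"
proof -
  have "{1..m} = insert m {1..<m}" using assms by auto
  then show ?thesis by (simp add: bary_def)
qed

lemma emeasure_corner_simplex_finite: "emeasure (lborel_on {1..<m}) (corner_simplex m) < \<infinity>"
proof -
  interpret product_sigma_finite "\<lambda>_::nat. lborel :: real measure"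
    by (rule product_sigma_finite_lborel)
  have "corner_simplex m \<subseteq> Pi\<^sub>E {1..<m} (\<lambda>_. {0..1})"
  proof (intro subsetI)
    fix x assume x: "x \<in> corner_simplex m"
    have "0 \<le> x i \<and> x i \<le> 1" if i: "i \<in> {1..<m}" for i
    proof -
      have nn: "0 \<le> x k" if "k \<in> {1..<m}" for k
        using x that by (auto simp: corner_simplex_def bary_def dest!: bspec[of _ _ k])
      then have "x i \<le> (\<Sum>k\<in>{1..<m}. x k)" using i by (intro member_le_sum) auto
      moreover have "(\<Sum>k\<in>{1..<m}. x k) \<le> 1"
        using x i by (auto simp: corner_simplex_def bary_def dest!: bspec[of _ _ m])
      ultimately show ?thesis using nn[OF i] by simp
    qed
    then show "x \<in> Pi\<^sub>E {1..<m} (\<lambda>_. {0..1})"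
      using x by (auto simp: corner_simplex_def space_PiM)
  qed
  then have "emeasure (lborel_on {1..<m}) (corner_simplex m) \<le>
      emeasure (lborel_on {1..<m}) (Pi\<^sub>E {1..<m} (\<lambda>_. {0..1}))"
    by (rule emeasure_mono) (simp add: sets_PiM_I_finite)
  also have "\<dots> = 1" by (subst emeasure_PiM) auto
  finally show ?thesis by (simp add: le_less_trans)
qed

text \<open>Together with finiteness this makes the uniform measure on the simplex a probability and
  lets the volume of the simplex cancel in \<open>volume_ratio\<close>.\<close>

lemma emeasure_corner_simplex_pos:
  assumes "m \<ge> 1" shows "emeasure (lborel_on {1..<m}) (corner_simplex m) > 0"
proof -
  interpret product_sigma_finite "\<lambda>_::nat. lborel :: real measure"
    by (rule product_sigma_finite_lborel)
  have "Pi\<^sub>E {1..<m} (\<lambda>_. {0..1 / real m}) \<subseteq> corner_simplex m"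
  proof (intro subsetI)
    fix x assume x: "x \<in> Pi\<^sub>E {1..<m} (\<lambda>_. {0..1 / real m})"
    have "(\<Sum>k\<in>{1..<m}. x k) \<le> (\<Sum>k\<in>{1..<m}. 1 / real m)"
      using x by (intro sum_mono) (auto simp: PiE_iff)
    also have "\<dots> \<le> 1" using assms by (simp add: field_simps)
    finally show "x \<in> corner_simplex m"
      using x by (auto simp: corner_simplex_def bary_def space_PiM PiE_iff)
  qed
  then have "emeasure (lborel_on {1..<m}) (Pi\<^sub>E {1..<m} (\<lambda>_. {0..1 / real m})) \<le>
      emeasure (lborel_on {1..<m}) (corner_simplex m)"
    by (rule emeasure_mono) simp
  moreover have "emeasure (lborel_on {1..<m}) (Pi\<^sub>E {1..<m} (\<lambda>_. {0..1 / real m})) =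
      ennreal ((1 / real m) ^ (m - 1))"
    by (subst emeasure_PiM) (auto simp: ennreal_power)
  moreover have "ennreal ((1 / real m) ^ (m - 1)) > 0" using assms by simp
  ultimately show ?thesis by (metis not_less order_less_le_trans)
qed

lemma sets_bary_law [simp, measurable_cong]: "sets (bary_law m) = sets (PiM {1..m} (\<lambda>_. borel))"
  by (simp add: bary_law_def)

lemma space_bary_law [simp]: "space (bary_law m) = {1..m} \<rightarrow>\<^sub>E UNIV"
  by (simp add: bary_law_def space_PiM)

lemma emeasure_bary_law:
  assumes B: "B \<in> sets (bary_law m)"
  shows "emeasure (bary_law m) B =
    emeasure (lborel_on {1..<m}) {x \<in> corner_simplex m. bary m x \<in> B} / emeasure (lborel_on {1..<m}) (corner_simplex m)"
proof -
  have B': "bary m -` B \<inter> space (lborel_on {1..<m}) \<in> sets (lborel_on {1..<m})"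
    using B by (intro measurable_sets[OF measurable_bary]) auto
  have "emeasure (bary_law m) B =
      emeasure (uniform_measure (lborel_on {1..<m}) (corner_simplex m)) (bary m -` B \<inter> space (lborel_on {1..<m}))"
    using B unfolding bary_law_def by (subst emeasure_distr) auto
  also have "\<dots> = emeasure (lborel_on {1..<m}) (corner_simplex m \<inter> (bary m -` B \<inter> space (lborel_on {1..<m})))
      / emeasure (lborel_on {1..<m}) (corner_simplex m)"
    using B' by simp
  also have "corner_simplex m \<inter> (bary m -` B \<inter> space (lborel_on {1..<m})) = {x \<in> corner_simplex m. bary m x \<in> B}"
    by (auto simp: corner_simplex_def)
  finally show ?thesis .
qed

lemma prob_space_bary_law:
  assumes "m \<ge> 1" shows "prob_space (bary_law m)"
  unfolding bary_law_def
proof (rule prob_space.prob_space_distr)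
  show "prob_space (uniform_measure (lborel_on {1..<m}) (corner_simplex m))"
    using emeasure_corner_simplex_finite[of m] emeasure_corner_simplex_pos[OF assms]
    by (intro prob_space_uniform_measure) auto
qed simp

lemma AE_bary_law_simplex:
  assumes "m \<ge> 1"
  shows "AE z in bary_law m. (\<forall>i\<in>{1..m}. 0 \<le> z i) \<and> (\<Sum>i\<in>{1..m}. z i) = 1"
proof -
  have "{z \<in> space (PiM {1..m} (\<lambda>_. borel)). (\<forall>i\<in>{1..m}. 0 \<le> z i) \<and> (\<Sum>i\<in>{1..m}. z i) = (1::real)}
      \<in> sets (PiM {1..m} (\<lambda>_. borel))"
    by measurable
  then show ?thesis
    unfolding bary_law_def using sum_bary[OF assms]
    by (subst AE_distr_iff) (auto intro!: AE_uniform_measureI simp: corner_simplex_def)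
qed

section \<open>Self-similarity of the simplex and its consequences for the coordinates\<close>

lemma measurable_contraction [measurable]:
  "contraction m i c \<in> measurable (PiM {1..m} (\<lambda>_. borel)) (PiM {1..m} (\<lambda>_. borel))"
  unfolding contraction_def by measurable

text \<open>Covers vertex \<open>m\<close> as well: it is the origin of the free coordinates, so for
  \<open>i = m\<close> these are only scaled and the shift by \<open>c\<close> shows up in the
  restored coordinate.\<close>

lemma bary_contraction:
  assumes i: "i \<in> {1..m}"
  shows "bary m (\<lambda>k\<in>{1..<m}. (if k = i then c else 0) + (1 - c) * x k) = contraction m i c (bary m x)"
proof -
  have "1 - (\<Sum>k\<in>{1..<m}. (if k = i then c else 0) + (1 - c) * x k) =
      (if m = i then c else 0) + (1 - c) * (1 - (\<Sum>k\<in>{1..<m}. x k))"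
  proof -
    have "(\<Sum>k\<in>{1..<m}. (if k = i then c else 0) + (1 - c) * x k) =
        (\<Sum>k\<in>{1..<m}. if k = i then c else 0) + (1 - c) * (\<Sum>k\<in>{1..<m}. x k)"
      by (simp only: sum.distrib sum_distrib_left)
    also have "(\<Sum>k\<in>{1..<m}. if k = i then c else 0) = (if m = i then 0 else c)"
      using i by auto
    finally show ?thesis by (auto simp: algebra_simps)
  qed
  then show ?thesis
    using i by (auto simp: fun_eq_iff bary_def contraction_def)
qed

text \<open>The part of the simplex where coordinate \<open>i\<close> is at least \<open>c\<close> is the image of the
  simplex under the contraction by \<open>1 - c\<close> towards vertex \<open>i\<close>.\<close>

lemma bary_law_self_similar_ge:
  assumes m: "m \<ge> 1" and i: "i \<in> {1..m}" and c: "0 \<le> c" "c < 1" and B: "B \<in> sets (bary_law m)"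
  shows "measure (bary_law m) {z \<in> B. c \<le> z i} =
    (1 - c) ^ (m - 1) * measure (bary_law m) {z \<in> space (bary_law m). contraction m i c z \<in> B}"
proof -
  let ?L = "lborel_on {1..<m}"
  have T: "{z \<in> space (bary_law m). contraction m i c z \<in> B} \<in> sets (bary_law m)"
    using measurable_sets[OF measurable_contraction, of B m] B
    by (simp add: vimage_def Int_def conj_commute space_PiM)
  have Bi: "{z \<in> B. c \<le> z i} \<in> sets (bary_law m)"
  proof -
    have "{z \<in> B. c \<le> z i} = B \<inter> {z \<in> space (PiM {1..m} (\<lambda>_. borel)). c \<le> z i}"
      using sets.sets_into_space[OF B] by (auto simp: space_PiM)
    also have "\<dots> \<in> sets (PiM {1..m} (\<lambda>_. borel))"
      using i B by (intro sets.Int) auto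
    finally show ?thesis by simp
  qed
  define \<tau> where "\<tau> x = (\<lambda>k\<in>{1..<m}. (if k = i then c else 0) + (1 - c) * x k)" for x :: "nat \<Rightarrow> real"
  have bt: "bary m (\<tau> x) = contraction m i c (bary m x)" for x
    unfolding \<tau>_def by (rule bary_contraction[OF i])
  have E: "{x \<in> corner_simplex m. bary m x \<in> B'} \<in> sets ?L" if "B' \<in> sets (bary_law m)" for B'
  proof -
    have "{x \<in> corner_simplex m. bary m x \<in> B'} = corner_simplex m \<inter> (bary m -` B' \<inter> space ?L)"
      by (auto simp: corner_simplex_def)
    then show ?thesis using that measurable_sets[OF measurable_bary, of B' m] by auto
  qed
  have "emeasure ?L {x \<in> corner_simplex m. bary m x \<in> {z \<in> B. c \<le> z i}} =
      ennreal ((1 - c) ^ card {1..<m}) *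
      emeasure ?L {x \<in> space ?L. \<tau> x \<in> {x \<in> corner_simplex m. bary m x \<in> {z \<in> B. c \<le> z i}}}"
    unfolding \<tau>_def using c Bi by (intro emeasure_lborel_on_affine_vimage E) auto
  also have "{x \<in> space ?L. \<tau> x \<in> {x \<in> corner_simplex m. bary m x \<in> {z \<in> B. c \<le> z i}}} =
      {x \<in> corner_simplex m. bary m x \<in> {z \<in> space (bary_law m). contraction m i c z \<in> B}}"
  proof -
    \<comment> \<open>Removing the shift turns \<open>c \<le> z i\<close> into nonnegativity of
      coordinate \<open>i\<close> before the contraction, and the other coordinates are only scaled;
      what remains is membership in the whole simplex.\<close>
    have "\<tau> x \<in> corner_simplex m \<and> c \<le> contraction m i c (bary m x) i \<longleftrightarrow> x \<in> corner_simplex m"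
      if x: "x \<in> space ?L" for x
    proof -
      have "\<tau> x \<in> space ?L" by (auto simp: \<tau>_def space_PiM)
      moreover have "(\<forall>k\<in>{1..m}. 0 \<le> contraction m i c (bary m x) k) \<and> c \<le> contraction m i c (bary m x) i
          \<longleftrightarrow> (\<forall>k\<in>{1..m}. 0 \<le> bary m x k)"
      proof
        assume *: "(\<forall>k\<in>{1..m}. 0 \<le> contraction m i c (bary m x) k) \<and> c \<le> contraction m i c (bary m x) i"
        show "\<forall>k\<in>{1..m}. 0 \<le> bary m x k"
        proof
          fix k assume k: "k \<in> {1..m}"
          have "0 \<le> (1 - c) * bary m x k"
            using * k i by (cases "k = i") (auto simp: contraction_def dest!: bspec[of _ _ k])
          then show "0 \<le> bary m x k" using c by (simp add: zero_le_mult_iff)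
        qed
      next
        assume *: "\<forall>k\<in>{1..m}. 0 \<le> bary m x k"
        then show "(\<forall>k\<in>{1..m}. 0 \<le> contraction m i c (bary m x) k) \<and> c \<le> contraction m i c (bary m x) i"
          using i c by (auto simp: contraction_def)
      qed
      ultimately show ?thesis using x by (simp add: corner_simplex_def bt)
    qed
    moreover have "bary m x \<in> space (bary_law m)" for x
      by (simp add: bary_def)
    ultimately show ?thesis by (auto simp: bt) (auto simp: corner_simplex_def)
  qed
  finally have "emeasure (bary_law m) {z \<in> B. c \<le> z i} =
      ennreal ((1 - c) ^ (m - 1)) * emeasure (bary_law m) {z \<in> space (bary_law m). contraction m i c z \<in> B}"
    using T Bi by (simp add: emeasure_bary_law ennreal_times_divide)
  then show ?thesis
    using c by (simp add: measure_def enn2real_mult)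
qed

lemma prob_bary_law_ge:
  assumes "m \<ge> 1" "i \<in> {1..m}" "0 \<le> c" "c < 1"
  shows "measure (bary_law m) {z \<in> space (bary_law m). c \<le> z i} = (1 - c) ^ (m - 1)"
proof -
  interpret prob_space "bary_law m" using assms by (intro prob_space_bary_law)
  have "{z \<in> space (bary_law m). contraction m i c z \<in> space (bary_law m)} = space (bary_law m)"
    by (auto simp: contraction_def)
  then show ?thesis
    using bary_law_self_similar_ge[OF assms sets.top] prob_space by simp
qed

text \<open>The exact tail \<open>(1 - c) ^ (m - 1)\<close> tends to 1 as \<open>c\<close> decreases
  to 0 and to 0 as \<open>c\<close> increases to 1. The second limit uses \<open>m \<ge> 2\<close>;
  for \<open>m = 1\<close> the only coordinate equals 1.\<close>

lemma AE_bary_law_interior: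
  assumes "m \<ge> 2"
  shows "AE z in bary_law m. (\<forall>i\<in>{1..m}. 0 < z i \<and> z i < 1) \<and> (\<Sum>i\<in>{1..m}. z i) = 1"
proof -
  interpret prob_space "bary_law m" using assms by (intro prob_space_bary_law) simp
  have meas: "{z \<in> space (bary_law m). Q (z i)} \<in> sets (bary_law m)"
    if "i \<in> {1..m}" "Measurable.pred borel Q" for Q :: "real \<Rightarrow> bool" and i
  proof -
    have "{z \<in> space (PiM {1..m} (\<lambda>_. borel)). Q (z i)} \<in> sets (PiM {1..m} (\<lambda>_. borel))"
      using that by measurable
    then show ?thesis by (simp add: space_PiM)
  qed
  have "AE z in bary_law m. 0 < z i" if i: "i \<in> {1..m}" for i
  proof -
    have "((\<lambda>c. (1 - c) ^ (m - 1)) \<longlongrightarrow> (1 - 0) ^ (m - 1)) (at_right (0::real))"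
      by (intro tendsto_intros)
    then have lim: "((\<lambda>c. (1 - c) ^ (m - 1)) \<longlongrightarrow> 1) (at_right (0::real))" by simp
    have "prob {z \<in> space (bary_law m). 0 < z i} \<ge> 1"
    proof (rule tendsto_upperbound[OF lim])
      have "(1 - c) ^ (m - 1) \<le> prob {z \<in> space (bary_law m). 0 < z i}" if "0 < c" "c < 1" for c
        using that i assms by (subst prob_bary_law_ge[OF _ i, of c, symmetric])
          (auto intro!: finite_measure_mono meas)
      then show "\<forall>\<^sub>F c in at_right 0. (1 - c) ^ (m - 1) \<le> prob {z \<in> space (bary_law m). 0 < z i}"
        unfolding eventually_at_right_field by (intro exI[of _ 1]) auto
    qed simp
    then have "prob {z \<in> space (bary_law m). 0 < z i} = 1" using prob_le_1 by (simp add: antisym)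
    then show ?thesis by (subst (asm) prob_Collect_eq_1[OF meas[OF i]]) auto
  qed
  moreover have "AE z in bary_law m. z i < 1" if i: "i \<in> {1..m}" for i
  proof -
    have "((\<lambda>c. (1 - c) ^ (m - 1)) \<longlongrightarrow> (1 - 1) ^ (m - 1)) (at_left (1::real))"
      by (intro tendsto_intros)
    then have lim: "((\<lambda>c. (1 - c) ^ (m - 1)) \<longlongrightarrow> 0) (at_left (1::real))"
      using assms by (simp add: power_0_left)
    have "prob {z \<in> space (bary_law m). 1 \<le> z i} \<le> 0"
    proof (rule tendsto_lowerbound[OF lim])
      have "prob {z \<in> space (bary_law m). 1 \<le> z i} \<le> (1 - c) ^ (m - 1)" if "0 < c" "c < 1" for c
        using that i assms by (subst prob_bary_law_ge[OF _ i, of c, symmetric])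
          (auto intro!: finite_measure_mono meas)
      then show "\<forall>\<^sub>F c in at_left 1. prob {z \<in> space (bary_law m). 1 \<le> z i} \<le> (1 - c) ^ (m - 1)"
        unfolding eventually_at_left_field by (intro exI[of _ 0]) auto
    qed simp
    then have "prob {z \<in> space (bary_law m). 1 \<le> z i} = 0" by (simp add: measure_le_0_iff)
    then have "AE z in bary_law m. \<not> 1 \<le> z i"
      by (subst (asm) prob_Collect_eq_0[OF meas[OF i]]) auto
    then show ?thesis by (simp add: not_le)
  qed
  ultimately have "AE z in bary_law m. \<forall>i\<in>{1..m}. 0 < z i \<and> z i < 1"
    by (intro eventually_ball_finite) auto
  then show ?thesis using AE_bary_law_simplex[of m] assms by auto
qed

text \<open>Strict and weak threshold differ by the image of the face \<open>z i = 0\<close> under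
  the contraction, and that face is a null set. The strict form is the complement of
  \<open>z i \<le> c\<close>, which the orthant estimates require.\<close>

lemma bary_law_self_similar_gt:
  assumes m: "m \<ge> 2" and i: "i \<in> {1..m}" and c: "0 \<le> c" "c < 1" and B: "B \<in> sets (bary_law m)"
  shows "measure (bary_law m) {z \<in> B. c < z i} =
    (1 - c) ^ (m - 1) * measure (bary_law m) {z \<in> space (bary_law m). contraction m i c z \<in> B}"
proof -
  interpret prob_space "bary_law m" using m by (intro prob_space_bary_law) simp
  let ?B = "{z \<in> B. c < z i}"
  have BM[measurable]: "B \<in> sets (PiM {1..m} (\<lambda>_. borel))" using B by simp
  have "?B = B \<inter> {z \<in> space (PiM {1..m} (\<lambda>_. borel)). c < z i}"
    using sets.sets_into_space[OF B] by (auto simp: space_PiM)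
  also have "\<dots> \<in> sets (PiM {1..m} (\<lambda>_. borel))"
    using i by (intro sets.Int BM) auto
  finally have B': "?B \<in> sets (bary_law m)" by simp
  have sT: "{z \<in> space (bary_law m). contraction m i c z \<in> B'} \<in> sets (bary_law m)"
    if "B' \<in> sets (bary_law m)" for B'
    using measurable_sets[OF measurable_contraction, of B' m] that
    by (simp add: vimage_def Int_def conj_commute space_PiM)
  have "measure (bary_law m) ?B = measure (bary_law m) {z \<in> ?B. c \<le> z i}"
    by (rule arg_cong[where f = "measure _"]) auto
  also have "\<dots> = (1 - c) ^ (m - 1) * prob {z \<in> space (bary_law m). contraction m i c z \<in> ?B}"
    using m by (intro bary_law_self_similar_ge[OF _ i c B']) simp
  also have "prob {z \<in> space (bary_law m). contraction m i c z \<in> ?B} =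
      prob {z \<in> space (bary_law m). contraction m i c z \<in> B}"
  proof (rule finite_measure_eq_AE)
    show "AE z in bary_law m. (z \<in> {z \<in> space (bary_law m). contraction m i c z \<in> ?B}) =
        (z \<in> {z \<in> space (bary_law m). contraction m i c z \<in> B})"
      using AE_bary_law_interior[OF m]
    proof eventually_elim
      case (elim z)
      then have "c < contraction m i c z i"
        using i c by (auto simp: contraction_def)
      then show ?case by auto
    qed
  qed (intro sT B B')+
  finally show ?thesis .
qed

lemma prob_bary_law_gt:
  assumes "m \<ge> 2" "i \<in> {1..m}" "0 \<le> c" "c \<le> 1"
  shows "measure (bary_law m) {z \<in> space (bary_law m). c < z i} = (1 - c) ^ (m - 1)"
proof -
  interpret prob_space "bary_law m" using assms by (intro prob_space_bary_law) simp
  have *: "{z \<in> space (bary_law m). contraction m i c z \<in> space (bary_law m)} = space (bary_law m)"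
    by (auto simp: contraction_def)
  show ?thesis
  proof (cases "c = 1")
    \<comment> \<open>At \<open>c = 1\<close> the contraction collapses the simplex to a vertex, so
      this endpoint rests on \<open>AE_bary_law_interior\<close> instead.\<close>
    case True
    have "AE z in bary_law m. \<not> 1 < z i"
      by (rule eventually_mono[OF AE_bary_law_interior[OF assms(1)]]) (use assms(2) in force)
    moreover have "{z \<in> space (PiM {1..m} (\<lambda>_. borel)). 1 < z i} \<in> sets (PiM {1..m} (\<lambda>_. borel :: real measure))"
      using assms(2) by measurable
    ultimately have "prob {z \<in> space (bary_law m). 1 < z i} = 0"
      by (subst prob_Collect_eq_0) (auto simp: space_PiM)
    then show ?thesis using True assms(1) by (simp add: power_0_left)
  next
    case False
    then show ?thesis
      using bary_law_self_similar_gt[OF assms(1,2,3) _ sets.top] assms * prob_space by simp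
  qed
qed

text \<open>Given \<open>z i > y i\<close>, the law of \<open>z\<close> is the contracted one, whose remaining
  coordinates are smaller; so the events \<open>z i \<le> y i\<close> are negatively correlated.\<close>

lemma bary_law_negative_orthant:
  assumes m: "m \<ge> 2" and S: "S \<subseteq> {1..m}" and y: "\<And>i. i \<in> S \<Longrightarrow> 0 \<le> y i \<and> y i \<le> 1"
  shows "measure (bary_law m) {z \<in> space (bary_law m). \<forall>i\<in>S. z i \<le> y i} \<le>
    (\<Prod>i\<in>S. 1 - (1 - y i) ^ (m - 1))"
proof -
  interpret prob_space "bary_law m" using m by (intro prob_space_bary_law) simp
  have "finite S" using S by (rule finite_subset) simp
  then show ?thesis using S y
  proof (induction S rule: finite_induct)
    case empty
    then show ?case by simp
  next
    case (insert i S)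
    define B where "B = {z \<in> space (bary_law m). \<forall>k\<in>S. z k \<le> y k}"
    have sB: "B \<in> sets (bary_law m)"
    proof -
      have "{z \<in> space (PiM {1..m} (\<lambda>_. borel)). \<forall>k\<in>S. z k \<le> y k} \<in> sets (PiM {1..m} (\<lambda>_. borel :: real measure))"
        using insert by (intro sets.sets_Collect_finite_All) (auto intro!: borel_measurable_le)
      then show ?thesis by (simp add: B_def space_PiM)
    qed
    have iM: "i \<in> {1..m}" and yi: "0 \<le> y i" "y i \<le> 1" using insert.prems by auto
    have p: "0 \<le> (1 - y i) ^ (m - 1)" "(1 - y i) ^ (m - 1) \<le> 1"
      using yi by (auto intro: power_le_one)
    have Bgt: "{z \<in> B. y i < z i} = B \<inter> {z \<in> space (PiM {1..m} (\<lambda>_. borel)). y i < z i}"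
      by (auto simp: B_def space_PiM)
    have sBgt: "{z \<in> B. y i < z i} \<in> sets (bary_law m)"
      unfolding Bgt using sB iM by (auto intro!: sets.Int)
    have gt: "prob {z \<in> B. y i < z i} \<ge> (1 - y i) ^ (m - 1) * prob B"
    proof (cases "y i = 1")
      case True
      then show ?thesis using m by (simp add: power_0_left)
    next
      case False
      then have eq: "prob {z \<in> B. y i < z i} = (1 - y i) ^ (m - 1) *
          prob {z \<in> space (bary_law m). contraction m i (y i) z \<in> B}"
        using yi by (intro bary_law_self_similar_gt[OF m iM _ _ sB]) auto
      have "prob B \<le> prob {z \<in> space (bary_law m). contraction m i (y i) z \<in> B}"
      proof (rule finite_measure_mono_AE)
        show "AE z in bary_law m. z \<in> B \<longrightarrow> z \<in> {z \<in> space (bary_law m). contraction m i (y i) z \<in> B}"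
          using AE_bary_law_interior[OF m]
        proof eventually_elim
          case (elim z)
          have "contraction m i (y i) z k \<le> y k" if "z \<in> B" "k \<in> S" for k
          proof -
            have k: "k \<in> {1..m}" "k \<noteq> i" using that insert by auto
            then have "contraction m i (y i) z k = (1 - y i) * z k" by (simp add: contraction_def)
            also have "\<dots> \<le> 1 * z k" using elim k yi by (intro mult_right_mono) (auto intro: less_imp_le)
            also have "\<dots> \<le> y k" using that by (simp add: B_def)
            finally show ?thesis .
          qed
          moreover have "contraction m i (y i) z \<in> space (bary_law m)" by (simp add: contraction_def)
          ultimately show ?case by (auto simp: B_def)
        qed
        show "{z \<in> space (bary_law m). contraction m i (y i) z \<in> B} \<in> sets (bary_law m)"
          using measurable_sets[OF measurable_contraction, of B m] sB
          by (simp add: vimage_def Int_def conj_commute space_PiM)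
      qed
      with p show ?thesis unfolding eq by (intro mult_left_mono)
    qed
    have "{z \<in> space (bary_law m). \<forall>k\<in>insert i S. z k \<le> y k} = B - {z \<in> B. y i < z i}"
      by (auto simp: B_def)
    then have "prob {z \<in> space (bary_law m). \<forall>k\<in>insert i S. z k \<le> y k} = prob B - prob {z \<in> B. y i < z i}"
      using sB sBgt by (simp add: finite_measure_Diff)
    also have "\<dots> \<le> (1 - (1 - y i) ^ (m - 1)) * prob B"
      using gt by (simp add: algebra_simps)
    also have "\<dots> \<le> (1 - (1 - y i) ^ (m - 1)) * (\<Prod>k\<in>S. 1 - (1 - y k) ^ (m - 1))"
      using insert p unfolding B_def by (intro mult_left_mono insert.IH) auto
    also have "\<dots> = (\<Prod>k\<in>insert i S. 1 - (1 - y k) ^ (m - 1))"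
      using insert by simp
    finally show ?case .
  qed
qed

text \<open>Counterpart of \<open>bary_law_negative_orthant\<close>: the two bounds agree to first
  order in the terms \<open>(1 - y i) ^ (m - 1)\<close>, which makes the product bound sharp near y
  = (1, ..., 1).\<close>

lemma bary_law_union_bound:
  assumes m: "m \<ge> 2" and y: "\<And>i. i \<in> {1..m} \<Longrightarrow> 0 \<le> y i \<and> y i \<le> 1"
  shows "measure (bary_law m) {z \<in> space (bary_law m). \<forall>i\<in>{1..m}. z i \<le> y i} \<ge>
    1 - (\<Sum>i\<in>{1..m}. (1 - y i) ^ (m - 1))"
proof -
  interpret prob_space "bary_law m" using m by (intro prob_space_bary_law) simp
  let ?A = "\<lambda>i. {z \<in> space (bary_law m). y i < z i}"
  have sA: "?A i \<in> sets (bary_law m)" if "i \<in> {1..m}" for i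
  proof -
    have "{z \<in> space (PiM {1..m} (\<lambda>_. borel)). y i < z i} \<in> sets (PiM {1..m} (\<lambda>_. borel :: real measure))"
      using that by measurable
    then show ?thesis by (simp add: space_PiM)
  qed
  have "{z \<in> space (bary_law m). \<forall>i\<in>{1..m}. z i \<le> y i} = space (bary_law m) - (\<Union>i\<in>{1..m}. ?A i)"
    by (auto simp: not_less)
  then have "prob {z \<in> space (bary_law m). \<forall>i\<in>{1..m}. z i \<le> y i} = 1 - prob (\<Union>i\<in>{1..m}. ?A i)"
    using sA by (simp only:) (intro prob_compl sets.finite_UN, auto)
  moreover have "prob (\<Union>i\<in>{1..m}. ?A i) \<le> (\<Sum>i\<in>{1..m}. prob (?A i))"
    using sA by (intro finite_measure_subadditive_finite) auto
  moreover have "(\<Sum>i\<in>{1..m}. prob (?A i)) = (\<Sum>i\<in>{1..m}. (1 - y i) ^ (m - 1))"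
    using y by (intro sum.cong refl prob_bary_law_gt[OF m]) auto
  ultimately show ?thesis by simp
qed

section \<open>Reduction to independent columns\<close>

definition column_law :: "nat \<Rightarrow> nat \<Rightarrow> (nat \<Rightarrow> nat \<Rightarrow> real) measure" where
  "column_law m n = PiM {1..n} (\<lambda>_. bary_law m)"

text \<open>The index order is transposed: \<open>z j i\<close> stands for \<open>x (i, j)\<close>,
  so that the independent factors, the columns, are indexed first.\<close>

definition column_points :: "nat \<Rightarrow> nat \<Rightarrow> (nat \<times> nat \<Rightarrow> real) \<Rightarrow> nat \<Rightarrow> nat \<Rightarrow> real" where
  "column_points m n x = (\<lambda>j\<in>{1..n}. bary m (\<lambda>i\<in>{1..<m}. x (i, j)))"

definition column_simplices :: "nat \<Rightarrow> nat \<Rightarrow> (nat \<times> nat \<Rightarrow> real) set" where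
  "column_simplices m n = {x \<in> space (lborel_on ({1..<m} \<times> {1..n})).
     \<forall>j\<in>{1..n}. (\<lambda>i\<in>{1..<m}. x (i, j)) \<in> corner_simplex m}"

lemma product_prob_space_bary_law: "m \<ge> 1 \<Longrightarrow> product_prob_space (\<lambda>_. bary_law m)"
  by (intro product_prob_spaceI prob_space_bary_law)

lemma prob_space_column_law: "m \<ge> 1 \<Longrightarrow> prob_space (column_law m n)"
  unfolding column_law_def by (intro prob_space_PiM prob_space_bary_law)

lemma sets_column_law [simp, measurable_cong]:
  "sets (column_law m n) = sets (PiM {1..n} (\<lambda>_. PiM {1..m} (\<lambda>_. borel)))"
  unfolding column_law_def by (intro sets_PiM_cong) simp_all

lemma space_column_law [simp]: "space (column_law m n) = {1..n} \<rightarrow>\<^sub>E ({1..m} \<rightarrow>\<^sub>E UNIV)"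
  by (simp add: column_law_def space_PiM)

lemma measurable_select_column [measurable]:
  "j \<in> J \<Longrightarrow> (\<lambda>x. \<lambda>i\<in>I. x (i, j)) \<in> measurable (lborel_on (I \<times> J)) (lborel_on I)"
  by (intro measurable_restrict measurable_component_singleton) auto

lemma measurable_column_points [measurable]:
  "column_points m n \<in> measurable (lborel_on ({1..<m} \<times> {1..n})) (PiM {1..n} (\<lambda>_. PiM {1..m} (\<lambda>_. borel)))"
  unfolding column_points_def
  by (intro measurable_restrict measurable_compose[OF measurable_select_column measurable_bary])

lemma sets_column_simplices [measurable]:
  "column_simplices m n \<in> sets (lborel_on ({1..<m} \<times> {1..n}))"
proof -
  have "{x \<in> space (lborel_on ({1..<m} \<times> {1..n})). (\<lambda>i\<in>{1..<m}. x (i, j)) \<in> corner_simplex m}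
      \<in> sets (lborel_on ({1..<m} \<times> {1..n}))" if "j \<in> {1..n}" for j
    using measurable_sets[OF measurable_select_column[OF that] sets_corner_simplex]
    by (simp add: vimage_def Int_def conj_commute)
  then show ?thesis unfolding column_simplices_def by (intro sets.sets_Collect_finite_All) auto
qed

lemma emeasure_column_simplices:
  "emeasure (lborel_on ({1..<m} \<times> {1..n})) (column_simplices m n) =
    emeasure (lborel_on {1..<m}) (corner_simplex m) ^ n"
  unfolding column_simplices_def by (subst emeasure_lborel_on_Times_columns) auto

text \<open>Lebesgue measure on matrices is a product over columns and
  \<open>column_simplices\<close> constrains each column separately, so the normalisation also
  splits column by column.\<close>

lemma distr_column_points:
  assumes m: "m \<ge> 1"
  shows "distr (uniform_measure (lborel_on ({1..<m} \<times> {1..n})) (column_simplices m n))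
      (PiM {1..n} (\<lambda>_. PiM {1..m} (\<lambda>_. borel))) (column_points m n) = column_law m n"
proof -
  let ?L = "lborel_on ({1..<m} \<times> {1..n})" and ?S = "emeasure (lborel_on {1..<m}) (corner_simplex m)"
  interpret product_prob_space "\<lambda>_::nat. bary_law m" by (rule product_prob_space_bary_law[OF m])
  show ?thesis
    unfolding column_law_def
  proof (rule PiM_eqI)
    show "sets (distr (uniform_measure ?L (column_simplices m n))
        (PiM {1..n} (\<lambda>_. PiM {1..m} (\<lambda>_. borel))) (column_points m n)) = sets (PiM {1..n} (\<lambda>_. bary_law m))"
      by (simp add: column_law_def[symmetric])
    fix A assume A: "\<And>j. j \<in> {1..n} \<Longrightarrow> A j \<in> sets (bary_law m)"
    define B where "B j = {x \<in> corner_simplex m. bary m x \<in> A j}" for j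
    have B: "B j \<in> sets (lborel_on {1..<m})" if "j \<in> {1..n}" for j
    proof -
      have "B j = corner_simplex m \<inter> (bary m -` A j \<inter> space (lborel_on {1..<m}))"
        by (auto simp: B_def corner_simplex_def)
      then show ?thesis using A[OF that] measurable_sets[OF measurable_bary, of "A j" m] by auto
    qed
    have PA: "Pi\<^sub>E {1..n} A \<in> sets (PiM {1..n} (\<lambda>_. PiM {1..m} (\<lambda>_. borel)))"
      using A by (intro sets_PiM_I_finite) auto
    have "emeasure (distr (uniform_measure ?L (column_simplices m n))
        (PiM {1..n} (\<lambda>_. PiM {1..m} (\<lambda>_. borel))) (column_points m n)) (Pi\<^sub>E {1..n} A) =
      emeasure ?L (column_simplices m n \<inter> (column_points m n -` Pi\<^sub>E {1..n} A \<inter> space ?L))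
        / emeasure ?L (column_simplices m n)"
      using PA measurable_sets[OF measurable_column_points PA] by (subst emeasure_distr) auto
    also have "column_simplices m n \<inter> (column_points m n -` Pi\<^sub>E {1..n} A \<inter> space ?L) =
        {x \<in> space ?L. \<forall>j\<in>{1..n}. (\<lambda>i\<in>{1..<m}. x (i, j)) \<in> B j}"
      by (auto simp: column_simplices_def column_points_def B_def PiE_iff)
    also have "emeasure ?L \<dots> = (\<Prod>j\<in>{1..n}. emeasure (lborel_on {1..<m}) (B j))"
      using B by (intro emeasure_lborel_on_Times_columns) auto
    also have "\<dots> / emeasure ?L (column_simplices m n) =
        (\<Prod>j\<in>{1..n}. emeasure (lborel_on {1..<m}) (B j) / ?S)"
      by (simp add: emeasure_column_simplices divide_ennreal_def prod.distrib ennreal_inverse_power)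
    also have "\<dots> = (\<Prod>j\<in>{1..n}. emeasure (bary_law m) (A j))"
      using A by (intro prod.cong refl) (simp add: emeasure_bary_law B_def)
    finally show "emeasure (distr (uniform_measure ?L (column_simplices m n))
        (PiM {1..n} (\<lambda>_. PiM {1..m} (\<lambda>_. borel))) (column_points m n)) (Pi\<^sub>E {1..n} A) =
      (\<Prod>j\<in>{1..n}. emeasure (bary_law m) (A j))" .
  qed simp
qed

text \<open>Normalising the Lebesgue measure on the feasible matrices produces
  \<open>column_law\<close>; the price is a power of the simplex volume that does not depend on the
  region \<open>G\<close>.\<close>

lemma emeasure_reduced:
  assumes m: "m \<ge> 1" and G: "G \<in> sets (column_law m n \<Otimes>\<^sub>M lborel_on {1..m})"
  shows "{(x, y). x \<in> column_simplices m n \<and> (column_points m n x, y) \<in> G}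
      \<in> sets (lborel_on ({1..<m} \<times> {1..n}) \<Otimes>\<^sub>M lborel_on {1..m})" (is "?H \<in> sets (?L \<Otimes>\<^sub>M ?Y)")
    and "emeasure (lborel_on ({1..<m} \<times> {1..n}) \<Otimes>\<^sub>M lborel_on {1..m})
        {(x, y). x \<in> column_simplices m n \<and> (column_points m n x, y) \<in> G} =
      emeasure (lborel_on {1..<m}) (corner_simplex m) ^ n * emeasure (column_law m n \<Otimes>\<^sub>M lborel_on {1..m}) G"
proof -
  let ?E = "column_simplices m n" and ?C = "PiM {1..n} (\<lambda>_. PiM {1..m} (\<lambda>_. borel :: real measure))"
  interpret Y: sigma_finite_measure ?Y
    by (intro product_sigma_finite.sigma_finite product_sigma_finite_lborel) simp
  have GC: "G \<in> sets (?C \<Otimes>\<^sub>M ?Y)"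
    using G by (simp cong: sets_pair_measure_cong)
  have T: "(\<lambda>(x, y). (column_points m n x, y)) \<in> measurable (?L \<Otimes>\<^sub>M ?Y) (?C \<Otimes>\<^sub>M ?Y)"
    by measurable
  have "?H = (?E \<times> space ?Y) \<inter> ((\<lambda>(x, y). (column_points m n x, y)) -` G \<inter> space (?L \<Otimes>\<^sub>M ?Y))"
    using sets.sets_into_space[OF G] sets.sets_into_space[OF sets_column_simplices]
    by (fastforce simp: space_pair_measure)
  also have "\<dots> \<in> sets (?L \<Otimes>\<^sub>M ?Y)"
    by (intro sets.Int pair_measureI sets_column_simplices sets.top measurable_sets[OF T GC])
  finally show H: "?H \<in> sets (?L \<Otimes>\<^sub>M ?Y)" .
  define f where "f z = emeasure ?Y (Pair z -` G)" for z
  have fC: "f \<in> borel_measurable ?C"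
    unfolding f_def by (rule Y.measurable_emeasure_Pair[OF GC])
  have E0: "emeasure ?L ?E \<noteq> 0" "emeasure ?L ?E \<noteq> \<infinity>"
    using emeasure_corner_simplex_pos[OF m] emeasure_corner_simplex_finite[of m]
    by (simp_all add: emeasure_column_simplices power_eq_top_ennreal less_top)
  have "emeasure (?L \<Otimes>\<^sub>M ?Y) ?H = (\<integral>\<^sup>+x. emeasure ?Y (Pair x -` ?H) \<partial>?L)"
    by (rule Y.emeasure_pair_measure_alt[OF H])
  also have "\<dots> = (\<integral>\<^sup>+x. f (column_points m n x) * indicator ?E x \<partial>?L)"
    by (intro nn_integral_cong) (auto simp: f_def vimage_def indicator_def)
  \<comment> \<open>Multiplying and dividing by the volume of the feasible matrices, which is
    neither 0 nor infinite, replaces the restricted integral by one over the uniform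
    measure.\<close>
  also have "\<dots> = emeasure ?L ?E * ((\<integral>\<^sup>+x. f (column_points m n x) * indicator ?E x \<partial>?L) / emeasure ?L ?E)"
    using E0 by (simp add: ennreal_times_divide mult.commute[of "emeasure ?L ?E"] ennreal_mult_divide_eq)
  also have "(\<integral>\<^sup>+x. f (column_points m n x) * indicator ?E x \<partial>?L) / emeasure ?L ?E =
      (\<integral>\<^sup>+x. f (column_points m n x) \<partial>uniform_measure ?L ?E)"
    by (rule nn_integral_uniform_measure[symmetric])
      (auto intro: measurable_compose[OF measurable_column_points fC])
  also have "\<dots> = (\<integral>\<^sup>+z. f z \<partial>distr (uniform_measure ?L ?E) ?C (column_points m n))"
    using fC by (subst nn_integral_distr) auto
  also have "\<dots> = (\<integral>\<^sup>+z. f z \<partial>column_law m n)"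
    by (simp only: distr_column_points[OF m])
  also have "\<dots> = emeasure (column_law m n \<Otimes>\<^sub>M ?Y) G"
    unfolding f_def by (rule Y.emeasure_pair_measure_alt[OF G, symmetric])
  finally show "emeasure (?L \<Otimes>\<^sub>M ?Y) ?H =
      emeasure (lborel_on {1..<m}) (corner_simplex m) ^ n * emeasure (column_law m n \<Otimes>\<^sub>M ?Y) G"
    by (simp add: emeasure_column_simplices)
qed

text \<open>On \<open>demand_space\<close> the deleted row is determined by the others, so the
  projected set is exactly the set of \<open>emeasure_reduced\<close>. The factor in front is common
  to both relaxations and cancels in their ratio.\<close>

lemma Vol_eq:
  assumes m: "m \<ge> 1" and G: "G \<in> sets (column_law m n \<Otimes>\<^sub>M lborel_on {1..m})"
    and K: "K = {(x, y) \<in> demand_space m n.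
      (\<forall>i\<in>{1..m}. \<forall>j\<in>{1..n}. 0 \<le> x (i, j)) \<and> ((\<lambda>j\<in>{1..n}. \<lambda>i\<in>{1..m}. x (i, j)), y) \<in> G}"
  shows "Vol m n K = measure (lborel_on {1..<m}) (corner_simplex m) ^ n *
    measure (column_law m n \<Otimes>\<^sub>M lborel_on {1..m}) G"
proof -
  define cols where "cols x = (\<lambda>j\<in>{1..n}. \<lambda>i\<in>{1..m}. x (i, j))" for x :: "nat \<times> nat \<Rightarrow> real"
  have m_split: "{1..m} = insert m {1..<m}" using m by auto
  have cols_column_points: "column_points m n (restrict x ({1..<m} \<times> {1..n})) = cols x"
    if dem: "\<forall>j\<in>{1..n}. (\<Sum>i\<in>{1..m}. x (i, j)) = 1" for x
  proof -
    have "x (m, j) = 1 - (\<Sum>i\<in>{1..<m}. x (i, j))" if "j \<in> {1..n}" for j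
      using bspec[OF dem that] unfolding m_split by simp
    then show ?thesis
      by (auto simp: column_points_def bary_def cols_def fun_eq_iff)
  qed
  have "delete_last m n ` K = {(x, y). x \<in> column_simplices m n \<and> (column_points m n x, y) \<in> G}" (is "?l = ?r")
  proof (intro subset_antisym subsetI)
    fix p assume "p \<in> ?l"
    then obtain x y where xy: "(x, y) \<in> K" and p: "p = (restrict x ({1..<m} \<times> {1..n}), y)"
      by (auto simp: delete_last_def)
    then have dem: "\<forall>j\<in>{1..n}. (\<Sum>i\<in>{1..m}. x (i, j)) = 1"
      and nn: "\<forall>i\<in>{1..m}. \<forall>j\<in>{1..n}. 0 \<le> x (i, j)" and xG: "(cols x, y) \<in> G"
      by (auto simp: K demand_space_def cols_def)
    have "bary m (\<lambda>i\<in>{1..<m}. restrict x ({1..<m} \<times> {1..n}) (i, j)) = cols x j" if "j \<in> {1..n}" for j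
      using fun_cong[OF cols_column_points[OF dem], of j] that by (simp add: column_points_def)
    then have "restrict x ({1..<m} \<times> {1..n}) \<in> column_simplices m n"
      using nn by (auto simp: column_simplices_def corner_simplex_def space_PiM cols_def)
    then show "p \<in> ?r" using xG by (simp add: p cols_column_points[OF dem])
  next
    fix p assume "p \<in> ?r"
    then obtain x y where p: "p = (x, y)" and xE: "x \<in> column_simplices m n" and xG: "(column_points m n x, y) \<in> G"
      by auto
    \<comment> \<open>The preimage under \<open>delete_last\<close>: all \<open>m\<close> rows are
      read off the restored columns, the last one coming from \<open>bary\<close>.\<close>
    define x' where "x' = (\<lambda>ij\<in>{1..m} \<times> {1..n}. column_points m n x (snd ij) (fst ij))"
    have y: "y \<in> {1..m} \<rightarrow>\<^sub>E UNIV"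
      using sets.sets_into_space[OF G] xG by (auto simp: space_pair_measure space_PiM)
    have xsp: "x \<in> {1..<m} \<times> {1..n} \<rightarrow>\<^sub>E UNIV"
      using xE by (simp add: column_simplices_def space_PiM)
    have "restrict x' ({1..<m} \<times> {1..n}) = x"
      using xsp by (auto simp: x'_def column_points_def bary_def fun_eq_iff PiE_def extensional_def)
    moreover have "cols x' = column_points m n x"
      by (auto simp: cols_def x'_def column_points_def bary_def fun_eq_iff)
    moreover have "(\<Sum>i\<in>{1..m}. x' (i, j)) = 1" if "j \<in> {1..n}" for j
      using sum_bary[OF m] that by (simp add: x'_def column_points_def)
    moreover have "0 \<le> x' (i, j)" if "i \<in> {1..m}" "j \<in> {1..n}" for i j
      using xE that by (auto simp: x'_def column_points_def column_simplices_def corner_simplex_def)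
    moreover have "x' \<in> {1..m} \<times> {1..n} \<rightarrow>\<^sub>E UNIV" by (auto simp: x'_def)
    ultimately have "(x', y) \<in> K" "delete_last m n (x', y) = p"
      using y xG by (auto simp: K demand_space_def ambient_def cols_def[symmetric] delete_last_def p)
    then show "p \<in> ?l" by (metis imageI)
  qed
  \<comment> \<open>The projected set is measurable for the product measure itself, so the
    completion assigns it the same value.\<close>
  then have "Vol m n K = enn2real (emeasure (lborel_on {1..<m}) (corner_simplex m) ^ n *
      emeasure (column_law m n \<Otimes>\<^sub>M lborel_on {1..m}) G)"
    using emeasure_reduced[OF m G]
    by (simp add: Vol_def reduced_lebesgue_def measure_completion measure_def)
  also have "\<dots> = measure (lborel_on {1..<m}) (corner_simplex m) ^ n *
      measure (column_law m n \<Otimes>\<^sub>M lborel_on {1..m}) G"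
    using emeasure_corner_simplex_finite[of m]
    by (simp add: enn2real_mult emeasure_eq_ennreal_measure ennreal_power) (simp add: measure_def)
  finally show ?thesis .
qed

section \<open>The regions over the column law that represent the two relaxations\<close>

definition weak_region :: "nat \<Rightarrow> nat \<Rightarrow> ((nat \<Rightarrow> nat \<Rightarrow> real) \<times> (nat \<Rightarrow> real)) set" where
  "weak_region m n = {(z, y) \<in> space (column_law m n \<Otimes>\<^sub>M lborel_on {1..m}).
     \<forall>i\<in>{1..m}. (\<Sum>j\<in>{1..n}. z j i) / real n \<le> y i \<and> y i \<le> 1}"

definition strong_region :: "nat \<Rightarrow> nat \<Rightarrow> ((nat \<Rightarrow> nat \<Rightarrow> real) \<times> (nat \<Rightarrow> real)) set" where
  "strong_region m n = {(z, y) \<in> space (column_law m n \<Otimes>\<^sub>M lborel_on {1..m}).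
     \<forall>i\<in>{1..m}. (\<forall>j\<in>{1..n}. z j i \<le> y i) \<and> y i \<le> 1}"

lemma measurable_column_entry [measurable (raw)]:
  assumes "i \<in> {1..m}" "j \<in> {1..n}"
  shows "(\<lambda>z. z j i) \<in> borel_measurable (column_law m n)"
proof -
  have "(\<lambda>z. z j) \<in> measurable (column_law m n) (bary_law m)"
    unfolding column_law_def using assms by measurable
  moreover have "(\<lambda>z. z i) \<in> measurable (bary_law m) borel"
    using assms measurable_component_real[of i "{1..m}"] by simp
  ultimately show ?thesis by (rule measurable_compose)
qed

lemma measurable_y_entry:
  assumes "i \<in> {1..m}"
  shows "(\<lambda>y. y i) \<in> borel_measurable (lborel_on {1..m})"
  using measurable_component_singleton[OF assms, of "\<lambda>_. lborel :: real measure"] by simp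

lemma measurable_pair_entries:
  assumes "i \<in> {1..m}"
  shows "j \<in> {1..n} \<Longrightarrow> (\<lambda>p. fst p j i) \<in> borel_measurable (column_law m n \<Otimes>\<^sub>M lborel_on {1..m})"
    and "(\<lambda>p. snd p i) \<in> borel_measurable (column_law m n \<Otimes>\<^sub>M lborel_on {1..m})"
  using measurable_compose[OF measurable_fst measurable_column_entry[OF assms]]
    measurable_compose[OF measurable_snd measurable_y_entry[OF assms]] by blast+

lemma sets_regions:
  shows "weak_region m n \<in> sets (column_law m n \<Otimes>\<^sub>M lborel_on {1..m})" (is "_ \<in> sets ?M")
    and "strong_region m n \<in> sets (column_law m n \<Otimes>\<^sub>M lborel_on {1..m})"
proof -
  note borel = borel_measurable_sum borel_measurable_divide measurable_pair_entries borel_measurable_const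
  have "weak_region m n = {p \<in> space ?M.
      \<forall>i\<in>{1..m}. (\<Sum>j\<in>{1..n}. fst p j i) / real n \<le> snd p i \<and> snd p i \<le> 1}"
    by (auto simp: weak_region_def)
  also have "\<dots> \<in> sets ?M"
    by (intro sets.sets_Collect_finite_All sets.sets_Collect_conj borel_measurable_le borel finite_atLeastAtMost)
  finally show "weak_region m n \<in> sets ?M" .
  have "strong_region m n = {p \<in> space ?M.
      \<forall>i\<in>{1..m}. (\<forall>j\<in>{1..n}. fst p j i \<le> snd p i) \<and> snd p i \<le> 1}"
    by (auto simp: strong_region_def)
  also have "\<dots> \<in> sets ?M"
    by (intro sets.sets_Collect_finite_All sets.sets_Collect_conj borel_measurable_le borel finite_atLeastAtMost)
  finally show "strong_region m n \<in> sets ?M" .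
qed

lemma volume_ratio_eq:
  assumes m: "m \<ge> 1" and n: "n \<ge> 1"
  shows "volume_ratio m n = measure (column_law m n \<Otimes>\<^sub>M lborel_on {1..m}) (weak_region m n) /
    measure (column_law m n \<Otimes>\<^sub>M lborel_on {1..m}) (strong_region m n)"
proof -
  have sp: "((\<lambda>j\<in>{1..n}. \<lambda>i\<in>{1..m}. x (i, j)), y) \<in> space (column_law m n \<Otimes>\<^sub>M lborel_on {1..m})"
    if "(x, y) \<in> demand_space m n" for x y
    using that by (auto simp: demand_space_def ambient_def space_pair_measure space_PiM)
  have le1: "x (i, j) \<le> 1" if "(x, y) \<in> demand_space m n"
    "\<forall>i\<in>{1..m}. \<forall>j\<in>{1..n}. 0 \<le> x (i, j)" "i \<in> {1..m}" "j \<in> {1..n}" for x y i j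
  proof -
    have "x (i, j) \<le> (\<Sum>k\<in>{1..m}. x (k, j))" using that by (intro member_le_sum) auto
    also have "\<dots> = 1" using that by (simp add: demand_space_def)
    finally show ?thesis .
  qed
  have "weak_relaxation m n \<inter> demand_space m n = {(x, y) \<in> demand_space m n.
      (\<forall>i\<in>{1..m}. \<forall>j\<in>{1..n}. 0 \<le> x (i, j)) \<and> ((\<lambda>j\<in>{1..n}. \<lambda>i\<in>{1..m}. x (i, j)), y) \<in> weak_region m n}"
    using n le1 sp
    by (auto simp: weak_relaxation_def weak_region_def demand_space_def field_simps)
  note w = Vol_eq[OF m sets_regions(1) this]
  have "strong_relaxation m n \<inter> demand_space m n = {(x, y) \<in> demand_space m n.
      (\<forall>i\<in>{1..m}. \<forall>j\<in>{1..n}. 0 \<le> x (i, j)) \<and> ((\<lambda>j\<in>{1..n}. \<lambda>i\<in>{1..m}. x (i, j)), y) \<in> strong_region m n}"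
    using le1 sp
    by (auto simp: strong_relaxation_def strong_region_def demand_space_def)
  note s = Vol_eq[OF m sets_regions(2) this]
  have "measure (lborel_on {1..<m}) (corner_simplex m) > 0"
    using emeasure_corner_simplex_pos[OF m] emeasure_corner_simplex_finite[of m]
    by (simp add: measure_def enn2real_positive_iff)
  then show ?thesis by (simp add: volume_ratio_def w s)
qed

section \<open>Inequalities and one-dimensional integrals\<close>

text \<open>The Weierstrass product inequality, applied below to squares of deviations.\<close>

lemma one_minus_sum_le_prod:
  fixes a :: "'i \<Rightarrow> real"
  assumes "finite I" "\<And>i. i \<in> I \<Longrightarrow> 0 \<le> a i \<and> a i \<le> 1"
  shows "1 - (\<Sum>i\<in>I. a i) \<le> (\<Prod>i\<in>I. 1 - a i)"
  using assms
proof (induction I rule: finite_induct)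
  case (insert i I)
  have le1: "(\<Prod>i\<in>I. 1 - a i) \<le> 1" "0 \<le> (\<Prod>i\<in>I. 1 - a i)"
    using insert.prems by (auto intro!: prod_le_1 prod_nonneg)
  have "1 - (a i + (\<Sum>i\<in>I. a i)) \<le> (\<Prod>i\<in>I. 1 - a i) - a i * 1"
    using insert by simp
  also have "\<dots> \<le> (\<Prod>i\<in>I. 1 - a i) - a i * (\<Prod>i\<in>I. 1 - a i)"
    using le1 insert.prems by (intro diff_left_mono mult_left_mono) auto
  finally show ?case using insert by (simp add: algebra_simps)
qed simp

text \<open>The factors \<open>exp (- u i)\<close> multiply to 1 because the exponents cancel, and
  each \<open>1 - u i\<close> agrees with \<open>exp (- u i)\<close> up to second order: exp (- u)
  (1 - u^2) \<le> 1 - u \<le> exp (- u).\<close>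

lemma prod_one_minus_balanced:
  fixes u :: "'i \<Rightarrow> real"
  assumes "finite I" and sum0: "(\<Sum>i\<in>I. u i) = 0" and u: "\<And>i. i \<in> I \<Longrightarrow> \<bar>u i\<bar> \<le> 1"
  shows "(\<Prod>i\<in>I. 1 - u i) \<le> 1" and "1 - (\<Sum>i\<in>I. (u i)\<^sup>2) \<le> (\<Prod>i\<in>I. 1 - u i)"
proof -
  have e: "(\<Prod>i\<in>I. exp (- u i)) = 1"
    using assms(1) sum0 by (simp add: exp_sum[symmetric] sum_negf)
  have "(\<Prod>i\<in>I. 1 - u i) \<le> (\<Prod>i\<in>I. exp (- u i))"
    using u exp_ge_add_one_self[of "- u _"] by (intro prod_mono) (auto simp: abs_le_iff)
  with e show "(\<Prod>i\<in>I. 1 - u i) \<le> 1" by simp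
  have step: "exp (- u i) * (1 - (u i)\<^sup>2) \<le> 1 - u i" "0 \<le> exp (- u i) * (1 - (u i)\<^sup>2)" if "i \<in> I" for i
  proof -
    have "1 - (u i)\<^sup>2 = (1 + u i) * (1 - u i)" by (simp add: power2_eq_square algebra_simps)
    also have "\<dots> \<le> exp (u i) * (1 - u i)"
      using u[OF that] by (intro mult_right_mono exp_ge_add_one_self) auto
    finally have "exp (- u i) * (1 - (u i)\<^sup>2) \<le> exp (- u i) * (exp (u i) * (1 - u i))"
      by (intro mult_left_mono) auto
    also have "\<dots> = 1 - u i" by (simp add: mult.assoc[symmetric] exp_add[symmetric])
    finally show "exp (- u i) * (1 - (u i)\<^sup>2) \<le> 1 - u i" .
    show "0 \<le> exp (- u i) * (1 - (u i)\<^sup>2)" using u[OF that] by (simp add: abs_square_le_1)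
  qed
  have "1 - (\<Sum>i\<in>I. (u i)\<^sup>2) \<le> (\<Prod>i\<in>I. 1 - (u i)\<^sup>2)"
    using assms(1) u by (intro one_minus_sum_le_prod) (auto simp: abs_square_le_1)
  also have "\<dots> = (\<Prod>i\<in>I. exp (- u i) * (1 - (u i)\<^sup>2))"
    using e by (simp add: prod.distrib)
  also have "\<dots> \<le> (\<Prod>i\<in>I. 1 - u i)"
    using step by (intro prod_mono) auto
  finally show "1 - (\<Sum>i\<in>I. (u i)\<^sup>2) \<le> (\<Prod>i\<in>I. 1 - u i)" .
qed

text \<open>With r = 1 - 1/m, write \<open>1 - s i = r * (1 - u i)\<close>; the \<open>u i\<close>
  sum to 0, so the balanced estimate applies. The constant 4 bounds 1/r^2, as r \<ge> 1/2 for
  \<open>m \<ge> 2\<close>.\<close>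

lemma prod_one_minus_near_barycenter:
  fixes s :: "nat \<Rightarrow> real"
  assumes m: "m \<ge> 2" and s: "\<And>i. i \<in> {1..m} \<Longrightarrow> 0 \<le> s i \<and> s i \<le> 1"
    and sum: "(\<Sum>i\<in>{1..m}. s i) = 1"
  shows "(\<Prod>i\<in>{1..m}. 1 - s i) \<le> (1 - 1 / real m) ^ m"
    and "(1 - 1 / real m) ^ m * (1 - 4 * (\<Sum>i\<in>{1..m}. (s i - 1 / real m)\<^sup>2)) \<le> (\<Prod>i\<in>{1..m}. 1 - s i)"
proof -
  define r where "r = 1 - 1 / real m"
  have r: "1 / 2 \<le> r" "1 / real m \<le> r" using m by (auto simp: r_def field_simps)
  define u where "u i = (s i - 1 / real m) / r" for i
  have "(\<Sum>i\<in>{1..m}. u i) = ((\<Sum>i\<in>{1..m}. s i) - (\<Sum>i\<in>{1..m}. 1 / real m)) / r"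
    by (simp add: u_def sum_divide_distrib[symmetric] sum_subtractf)
  then have u0: "(\<Sum>i\<in>{1..m}. u i) = 0" using m sum by simp
  have u1: "\<bar>u i\<bar> \<le> 1" if "i \<in> {1..m}" for i
    using s[OF that] r by (auto simp: u_def abs_le_iff field_simps) (auto simp: r_def)
  have su: "1 - s i = r * (1 - u i)" for i
  proof -
    have "r * (1 - v / r) = r - v" for v using r by (simp add: field_simps)
    then show ?thesis by (simp add: u_def r_def)
  qed
  have P: "(\<Prod>i\<in>{1..m}. 1 - s i) = r ^ m * (\<Prod>i\<in>{1..m}. 1 - u i)"
    by (simp add: su prod.distrib)
  have rm: "0 \<le> r ^ m" using r by simp
  show "(\<Prod>i\<in>{1..m}. 1 - s i) \<le> (1 - 1 / real m) ^ m"
    using mult_left_mono[OF prod_one_minus_balanced(1)[OF _ u0 u1] rm] P by (simp add: r_def)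
  have "(\<Sum>i\<in>{1..m}. (u i)\<^sup>2) \<le> (\<Sum>i\<in>{1..m}. 4 * (s i - 1 / real m)\<^sup>2)"
  proof (rule sum_mono)
    fix i
    have "(1 / 2)\<^sup>2 \<le> r\<^sup>2" using r by (intro power_mono) auto
    then have "(s i - 1 / real m)\<^sup>2 * 1 \<le> (s i - 1 / real m)\<^sup>2 * (4 * r\<^sup>2)"
      by (intro mult_left_mono) (auto simp: power_divide)
    then show "(u i)\<^sup>2 \<le> 4 * (s i - 1 / real m)\<^sup>2"
      using r by (simp add: u_def power_divide field_simps)
  qed
  then have "1 - 4 * (\<Sum>i\<in>{1..m}. (s i - 1 / real m)\<^sup>2) \<le> 1 - (\<Sum>i\<in>{1..m}. (u i)\<^sup>2)"
    by (simp add: sum_distrib_left)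
  also have "\<dots> \<le> (\<Prod>i\<in>{1..m}. 1 - u i)"
    using u0 u1 by (intro prod_one_minus_balanced(2)) auto
  finally show "(1 - 1 / real m) ^ m * (1 - 4 * (\<Sum>i\<in>{1..m}. (s i - 1 / real m)\<^sup>2)) \<le> (\<Prod>i\<in>{1..m}. 1 - s i)"
    unfolding P r_def[symmetric] using rm by (intro mult_left_mono)
qed

text \<open>\<open>pow_primitive p n\<close> is the primitive of \<open>(1 - t ^ p) ^ n\<close> that vanishes at \<open>0\<close>; the
  recursion is integration by parts.\<close>

fun pow_primitive :: "nat \<Rightarrow> nat \<Rightarrow> real \<Rightarrow> real" where
  "pow_primitive p 0 t = t"
| "pow_primitive p (Suc n) t =
    (t * (1 - t ^ p) ^ Suc n + real (Suc n) * real p * pow_primitive p n t) / (1 + real (Suc n) * real p)"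

lemma pow_primitive_0 [simp]: "pow_primitive p n 0 = 0"
  by (induction n) auto

lemma DERIV_pow_primitive:
  assumes "p \<ge> 1"
  shows "(pow_primitive p n has_real_derivative (1 - t ^ p) ^ n) (at t within A)"
proof (induction n)
  case 0
  have "pow_primitive p 0 = (\<lambda>t. t)" by (rule ext) simp
  then show ?case by simp
next
  case (Suc n)
  define d where "d = 1 + real (Suc n) * real p"
  have d: "d > 0" by (simp add: d_def add_pos_nonneg)
  have tp: "t * t ^ (p - 1) = t ^ p" using assms by (metis power_eq_if not_one_le_zero)
  have eq: "pow_primitive p (Suc n) =
      (\<lambda>t. (t * (1 - t ^ p) ^ Suc n + real (Suc n) * real p * pow_primitive p n t) / d)"
    by (rule ext) (simp add: d_def)
  have "((\<lambda>t. (t * (1 - t ^ p) ^ Suc n + real (Suc n) * real p * pow_primitive p n t) / d) has_real_derivative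
      ((1 - t ^ p) ^ Suc n + t * (real (Suc n) * (1 - t ^ p) ^ n * (- (real p * t ^ (p - 1))))
        + real (Suc n) * real p * (1 - t ^ p) ^ n) / d) (at t within A)"
    by (rule DERIV_cdivide) (rule derivative_eq_intros Suc.IH refl | simp add: One_nat_def algebra_simps)+
  also have "(1 - t ^ p) ^ Suc n + t * (real (Suc n) * (1 - t ^ p) ^ n * (- (real p * t ^ (p - 1))))
        + real (Suc n) * real p * (1 - t ^ p) ^ n =
      (1 - t ^ p) ^ Suc n + real (Suc n) * real p * (1 - t ^ p) ^ n * (1 - t * t ^ (p - 1))"
    by (simp add: algebra_simps)
  also have "\<dots> = d * (1 - t ^ p) ^ Suc n"
    unfolding tp by (simp add: d_def algebra_simps)
  finally show ?case unfolding eq using d by simp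
qed

text \<open>At \<open>t = 1\<close> the boundary term of the recursion vanishes and only its
  quotients remain. With a = 1/p the value is the beta integral a B(a, n + 1).\<close>

lemma pow_primitive_1:
  assumes "p \<ge> 1"
  shows "pow_primitive p n 1 = (\<Prod>k\<in>{1..n}. real k / (real k + 1 / real p))"
proof (induction n)
  case (Suc n)
  have "pow_primitive p (Suc n) 1 = real (Suc n) * real p / (1 + real (Suc n) * real p) * pow_primitive p n 1"
    using assms by (simp add: zero_power)
  also have "real (Suc n) * real p / (1 + real (Suc n) * real p) = real (Suc n) / (real (Suc n) + 1 / real p)"
    using assms by (simp add: field_simps)
  finally show ?case by (simp add: Suc.IH mult.commute)
qed simp

text \<open>On \<open>[\<delta>, 1]\<close> the decreasing integrand is at most its value at
  \<open>\<delta>\<close>. This controls what is lost when the integral is restricted to a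
  neighbourhood of the corner.\<close>

lemma pow_primitive_ge:
  assumes p: "p \<ge> 1" and \<delta>: "0 \<le> \<delta>" "\<delta> < 1"
  shows "pow_primitive p n 1 - (1 - \<delta> ^ p) ^ n \<le> pow_primitive p n \<delta>"
proof -
  obtain \<xi> where \<xi>: "\<delta> < \<xi>" "\<xi> < 1"
    "pow_primitive p n 1 - pow_primitive p n \<delta> = (1 - \<delta>) * (1 - \<xi> ^ p) ^ n"
    using MVT2[OF \<delta>(2), of "pow_primitive p n" "\<lambda>t. (1 - t ^ p) ^ n"] DERIV_pow_primitive[OF p] by blast
  have "(1 - \<delta>) * (1 - \<xi> ^ p) ^ n \<le> 1 * (1 - \<delta> ^ p) ^ n"
    using \<xi> \<delta> by (intro mult_mono power_mono diff_left_mono) (auto intro!: power_le_one zero_le_power)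
  with \<xi> show ?thesis by simp
qed

text \<open>The substitution \<open>t = 1 - y\<close>: the variable of \<open>pow_primitive\<close>
  measures the distance of a coordinate of \<open>y\<close> from the corner value 1.\<close>

lemma nn_integral_pow_primitive:
  assumes p: "p \<ge> 1" and \<delta>: "0 \<le> \<delta>" "\<delta> \<le> 1"
  shows "(\<integral>\<^sup>+y. ennreal ((1 - (1 - y) ^ p) ^ n) * indicator {1 - \<delta>..1} y \<partial>lborel) =
    ennreal (pow_primitive p n \<delta>)"
proof -
  have "(\<integral>\<^sup>+y. ennreal ((1 - (1 - y) ^ p) ^ n) * indicator {1 - \<delta>..1} y \<partial>lborel) =
      ennreal ((- pow_primitive p n (1 - 1)) - (- pow_primitive p n (1 - (1 - \<delta>))))"
  proof (rule nn_integral_FTC_Icc[where F = "\<lambda>y. - pow_primitive p n (1 - y)"])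
    fix y :: real assume y: "y \<in> {1 - \<delta>..1}"
    show "0 \<le> (1 - (1 - y) ^ p) ^ n" using y \<delta> by (intro zero_le_power) (auto intro: power_le_one)
    have "((\<lambda>y. 1 - y) has_real_derivative - 1) (at y)"
      by (rule derivative_eq_intros refl | simp)+
    from DERIV_minus[OF DERIV_chain2[OF DERIV_pow_primitive[OF p] this]]
    show "((\<lambda>y. - pow_primitive p n (1 - y)) has_real_derivative (1 - (1 - y) ^ p) ^ n) (at y)"
      by simp
  qed (use \<delta> in auto)
  then show ?thesis by simp
qed

text \<open>With q = (1 - t)^p, the geometric sum of the powers of 1 - q expresses 1 - (1 - q)^n as
  a multiple of q, which cancels the pole of \<open>1 / (1 - t)\<close>. The summands integrate to
  1/(p (k + 1)), hence the harmonic number.\<close>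

lemma nn_integral_hazard:
  assumes p: "p \<ge> 1"
  shows "(\<integral>\<^sup>+t. ennreal (1 / (1 - t)) * indicator {0..<1} t * ennreal (1 - (1 - (1 - t) ^ p) ^ n) \<partial>lborel)
    \<le> ennreal (harm n / real p)"
proof -
  let ?g = "\<lambda>t::real. \<Sum>k<n. (1 - t) ^ (p - 1) * (1 - (1 - t) ^ p) ^ k"
  let ?G = "\<lambda>t::real. \<Sum>k<n. (1 - (1 - t) ^ p) ^ Suc k / (real p * real (Suc k))"
  have "(\<integral>\<^sup>+t. ennreal (1 / (1 - t)) * indicator {0..<1} t * ennreal (1 - (1 - (1 - t) ^ p) ^ n) \<partial>lborel)
      \<le> (\<integral>\<^sup>+t. ennreal (?g t) * indicator {0..1} t \<partial>lborel)"
  proof (rule nn_integral_mono)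
    fix t :: real
    have "1 / (1 - t) * (1 - (1 - (1 - t) ^ p) ^ n) = ?g t" if "0 \<le> t" "t < 1"
    proof -
      have "1 - (1 - (1 - t) ^ p) ^ n = (1 - t) ^ p * (\<Sum>k<n. (1 - (1 - t) ^ p) ^ k)"
        using one_diff_power_eq[of "1 - (1 - t) ^ p" n] by simp
      moreover have "1 / (1 - t) * (1 - t) ^ p = (1 - t) ^ (p - 1)"
        using p that by (cases p) auto
      ultimately show ?thesis by (simp only: mult.assoc[symmetric] sum_distrib_left[symmetric])
    qed
    then show "ennreal (1 / (1 - t)) * indicator {0..<1} t * ennreal (1 - (1 - (1 - t) ^ p) ^ n)
        \<le> ennreal (?g t) * indicator {0..1} t"
      by (auto simp: indicator_def ennreal_mult'[symmetric])
  qed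
  also have "\<dots> = ennreal (?G 1 - ?G 0)"
  proof (rule nn_integral_FTC_Icc[where F = ?G])
    fix t :: real assume t: "t \<in> {0..1}"
    show "0 \<le> ?g t" using t by (intro sum_nonneg mult_nonneg_nonneg zero_le_power) (auto intro: power_le_one)
    have "((\<lambda>t. (1 - (1 - t) ^ p) ^ Suc k / (real p * real (Suc k))) has_real_derivative
        (real p * real (Suc k)) * ((1 - t) ^ (p - 1) * (1 - (1 - t) ^ p) ^ k) / (real p * real (Suc k))) (at t)" for k
      by (rule DERIV_cdivide) (rule derivative_eq_intros refl | simp add: One_nat_def algebra_simps)+
    then have "((\<lambda>t. (1 - (1 - t) ^ p) ^ Suc k / (real p * real (Suc k))) has_real_derivative
        (1 - t) ^ (p - 1) * (1 - (1 - t) ^ p) ^ k) (at t)" for k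
      using p by (subst (asm) nonzero_mult_div_cancel_left) auto
    then show "(?G has_real_derivative ?g t) (at t)" by (intro DERIV_sum)
  qed auto
  also have "?G 1 - ?G 0 = harm n / real p"
    using p by (simp add: zero_power harm_def sum_divide_distrib divide_inverse mult.commute
        sum.atLeast1_atMost_eq One_nat_def sum_distrib_left)
  finally show ?thesis .
qed

text \<open>Tonelli's theorem with a weight: the indicator of the unit interval gives the mean of an
  entry, and the additional factor \<open>1 / (1 - t)\<close> gives the mean of a logarithm.\<close>

lemma (in prob_space) nn_integral_layer_cake:
  fixes f :: "'a \<Rightarrow> real"
  assumes f: "f \<in> borel_measurable M" and h: "h \<in> borel_measurable lborel"
  shows "(\<integral>\<^sup>+z. (\<integral>\<^sup>+t. h t * indicator {..f z} t \<partial>lborel) \<partial>M) =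
    (\<integral>\<^sup>+t. h t * emeasure M {z \<in> space M. t \<le> f z} \<partial>lborel)"
proof -
  interpret pair_sigma_finite M "lborel :: real measure" ..
  note [measurable] = f h
  have [measurable]: "(\<lambda>p. indicator {..f (fst p)} (snd p) :: ennreal) \<in> borel_measurable (M \<Otimes>\<^sub>M lborel)"
  proof -
    have "(\<lambda>p. indicator {..f (fst p)} (snd p) :: ennreal) =
        (\<lambda>p. if snd p \<le> f (fst p) then 1 else 0)" by (auto simp: indicator_def)
    also have "\<dots> \<in> borel_measurable (M \<Otimes>\<^sub>M lborel)" by measurable
    finally show ?thesis .
  qed
  have "(\<integral>\<^sup>+z. (\<integral>\<^sup>+t. h t * indicator {..f z} t \<partial>lborel) \<partial>M) =
      (\<integral>\<^sup>+t. (\<integral>\<^sup>+z. h t * indicator {..f z} t \<partial>M) \<partial>lborel)"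
    by (rule Fubini'[symmetric]) (simp add: case_prod_unfold)
  also have "\<dots> = (\<integral>\<^sup>+t. h t * emeasure M {z \<in> space M. t \<le> f z} \<partial>lborel)"
  proof (rule nn_integral_cong)
    fix t
    have [measurable]: "{z \<in> space M. t \<le> f z} \<in> sets M" by measurable
    have "(\<integral>\<^sup>+z. h t * indicator {..f z} t \<partial>M) = (\<integral>\<^sup>+z. h t * indicator {z \<in> space M. t \<le> f z} z \<partial>M)"
      by (intro nn_integral_cong) (auto simp: indicator_def)
    then show "(\<integral>\<^sup>+z. h t * indicator {..f z} t \<partial>M) = h t * emeasure M {z \<in> space M. t \<le> f z}"
      by (simp add: nn_integral_cmult_indicator)
  qed
  finally show ?thesis .
qed

text \<open>Expanding the square, the mixed terms vanish because different components are
  independent and centred.\<close>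

lemma (in product_prob_space) second_moment_sum:
  fixes f :: "'a \<Rightarrow> real"
  assumes J: "finite J" and f: "\<And>j. j \<in> J \<Longrightarrow> integrable (M j) f"
    and f2: "\<And>j. j \<in> J \<Longrightarrow> integrable (M j) (\<lambda>z. (f z)\<^sup>2)"
    and mean: "\<And>j. j \<in> J \<Longrightarrow> (\<integral>z. f z \<partial>M j) = 0"
  shows "integrable (PiM J M) (\<lambda>z. (\<Sum>j\<in>J. f (z j))\<^sup>2)"
    and "(\<integral>z. (\<Sum>j\<in>J. f (z j))\<^sup>2 \<partial>PiM J M) = (\<Sum>j\<in>J. \<integral>z. (f z)\<^sup>2 \<partial>M j)"
proof -
  \<comment> \<open>Writes \<open>f (z j) * f (z k)\<close> as a product with one factor for every
    component, the form in which the integral over a product space factorises; diagonal and mixed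
    terms are covered together.\<close>
  define h where "h j k = (\<lambda>l z. if l = j \<and> l = k then (f z)\<^sup>2 else if l = j \<or> l = k then f z else 1)" for j k :: 'i
  have h: "(\<Prod>l\<in>J. h j k l (z l)) = f (z j) * f (z k)" if "j \<in> J" "k \<in> J" for j k z
  proof (cases "j = k")
    case True
    have "(\<Prod>l\<in>J. h j k l (z l)) = h j k j (z j) * (\<Prod>l\<in>J - {j}. h j k l (z l))"
      using J that by (simp add: prod.remove)
    also have "(\<Prod>l\<in>J - {j}. h j k l (z l)) = 1"
      using True by (intro prod.neutral) (auto simp: h_def)
    finally show ?thesis using True by (simp add: h_def power2_eq_square)
  next
    case False
    have "(\<Prod>l\<in>J. h j k l (z l)) = h j k j (z j) * (h j k k (z k) * (\<Prod>l\<in>J - {j} - {k}. h j k l (z l)))"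
      using J that False by (subst prod.remove[of J j]) (auto simp: prod.remove[of "J - {j}" k])
    also have "(\<Prod>l\<in>J - {j} - {k}. h j k l (z l)) = 1"
      by (intro prod.neutral) (auto simp: h_def)
    finally show ?thesis using False by (simp add: h_def)
  qed
  have hi: "integrable (M l) (h j k l)" if "l \<in> J" for j k l
    using f[OF that] f2[OF that] by (cases "l = j"; cases "l = k") (auto simp: h_def)
  have int: "integrable (PiM J M) (\<lambda>z. f (z j) * f (z k))" if "j \<in> J" "k \<in> J" for j k
    using product_integrable_prod[OF J, where f = "h j k"] hi by (simp add: h that)
  have val: "(\<integral>z. f (z j) * f (z k) \<partial>PiM J M) = (if k = j then \<integral>z. (f z)\<^sup>2 \<partial>M j else 0)"
    if "j \<in> J" "k \<in> J" for j k
  proof -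
    have "(\<integral>z. f (z j) * f (z k) \<partial>PiM J M) = (\<Prod>l\<in>J. integral\<^sup>L (M l) (h j k l))"
      using product_integral_prod[OF J, where f = "h j k"] hi by (simp add: h that)
    also have "\<dots> = (if k = j then \<integral>z. (f z)\<^sup>2 \<partial>M j else 0)"
    proof (cases "j = k")
      case True
      have "(\<Prod>l\<in>J. integral\<^sup>L (M l) (h j k l)) =
          integral\<^sup>L (M j) (h j k j) * (\<Prod>l\<in>J - {j}. integral\<^sup>L (M l) (h j k l))"
        using J that by (simp add: prod.remove)
      also have "(\<Prod>l\<in>J - {j}. integral\<^sup>L (M l) (h j k l)) = 1"
        using True by (intro prod.neutral) (auto simp: h_def M.prob_space)
      finally show ?thesis using True by (simp add: h_def)
    next
      case False
      then have "integral\<^sup>L (M j) (h j k j) = 0" using mean[OF that(1)] by (simp add: h_def)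
      then show ?thesis using False J that by (auto intro!: prod_zero)
    qed
    finally show ?thesis .
  qed
  have sq: "(\<Sum>j\<in>J. f (z j))\<^sup>2 = (\<Sum>j\<in>J. \<Sum>k\<in>J. f (z j) * f (z k))" for z
    by (simp add: power2_eq_square sum_product)
  show "integrable (PiM J M) (\<lambda>z. (\<Sum>j\<in>J. f (z j))\<^sup>2)"
    unfolding sq by (intro Bochner_Integration.integrable_sum int)
  show "(\<integral>z. (\<Sum>j\<in>J. f (z j))\<^sup>2 \<partial>PiM J M) = (\<Sum>j\<in>J. \<integral>z. (f z)\<^sup>2 \<partial>M j)"
    unfolding sq using J by (subst Bochner_Integration.integral_sum; (intro Bochner_Integration.integrable_sum int)?)
      (auto simp: val int intro!: sum.cong)
qed

section \<open>The weak relaxation\<close>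

lemma AE_column_law:
  assumes m: "m \<ge> 2"
  shows "AE z in column_law m n. \<forall>j\<in>{1..n}.
    (\<forall>i\<in>{1..m}. 0 < z j i \<and> z j i < 1) \<and> (\<Sum>i\<in>{1..m}. z j i) = 1"
  unfolding column_law_def using m
  by (intro eventually_ball_finite ballI AE_PiM_component prob_space_bary_law AE_bary_law_interior) auto

lemma sigma_finite_lborel_on: "finite I \<Longrightarrow> sigma_finite_measure (lborel_on I)"
  by (intro product_sigma_finite.sigma_finite product_sigma_finite_lborel)

text \<open>For fixed \<open>z\<close> the section in \<open>y\<close> is a box. It serves both
  relaxations, with \<open>\<phi> i\<close> the mean of row \<open>i\<close> for the weak and its
  maximum for the strong one.\<close>

lemma emeasure_above_graph:
  fixes \<phi> :: "nat \<Rightarrow> (nat \<Rightarrow> nat \<Rightarrow> real) \<Rightarrow> real"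
  assumes G: "{(z, y) \<in> space (column_law m n \<Otimes>\<^sub>M lborel_on {1..m}). \<forall>i\<in>{1..m}. \<phi> i z \<le> y i \<and> y i \<le> 1}
      \<in> sets (column_law m n \<Otimes>\<^sub>M lborel_on {1..m})"
  shows "emeasure (column_law m n \<Otimes>\<^sub>M lborel_on {1..m})
      {(z, y) \<in> space (column_law m n \<Otimes>\<^sub>M lborel_on {1..m}). \<forall>i\<in>{1..m}. \<phi> i z \<le> y i \<and> y i \<le> 1} =
    (\<integral>\<^sup>+z. (\<Prod>i\<in>{1..m}. ennreal (1 - \<phi> i z)) \<partial>column_law m n)" (is "emeasure _ ?G = _")
proof -
  interpret L: product_sigma_finite "\<lambda>_::nat. lborel :: real measure"
    by (rule product_sigma_finite_lborel)
  interpret Y: sigma_finite_measure "lborel_on {1..m}" by (rule sigma_finite_lborel_on) simp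
  show ?thesis
    unfolding Y.emeasure_pair_measure_alt[OF G]
  proof (rule nn_integral_cong)
    fix z assume z: "z \<in> space (column_law m n)"
    have "Pair z -` ?G = Pi\<^sub>E {1..m} (\<lambda>i. {\<phi> i z..1})"
      using z by (auto simp: space_pair_measure space_PiM PiE_iff extensional_def simp del: space_column_law)
    then have "emeasure (lborel_on {1..m}) (Pair z -` ?G) = (\<Prod>i\<in>{1..m}. emeasure lborel {\<phi> i z..1})"
      by (simp add: L.emeasure_PiM)
    \<comment> \<open>If \<open>\<phi> i z > 1\<close>, the interval is empty and
      \<open>ennreal\<close> truncates the negative length to 0, so the factors still agree.\<close>
    also have "\<dots> = (\<Prod>i\<in>{1..m}. ennreal (1 - \<phi> i z))"
      by (intro prod.cong refl) (auto simp: emeasure_lborel_Icc_eq ennreal_neg)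
    finally show "emeasure (lborel_on {1..m}) (Pair z -` ?G) = (\<Prod>i\<in>{1..m}. ennreal (1 - \<phi> i z))" .
  qed
qed

lemma measure_above_graph:
  fixes \<phi> :: "nat \<Rightarrow> (nat \<Rightarrow> nat \<Rightarrow> real) \<Rightarrow> real"
  assumes m: "m \<ge> 1"
    and G: "{(z, y) \<in> space (column_law m n \<Otimes>\<^sub>M lborel_on {1..m}). \<forall>i\<in>{1..m}. \<phi> i z \<le> y i \<and> y i \<le> 1}
      \<in> sets (column_law m n \<Otimes>\<^sub>M lborel_on {1..m})"
    and \<phi>: "\<And>i. i \<in> {1..m} \<Longrightarrow> \<phi> i \<in> borel_measurable (column_law m n)"
    and \<phi>01: "AE z in column_law m n. \<forall>i\<in>{1..m}. 0 \<le> \<phi> i z \<and> \<phi> i z \<le> 1"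
  shows "integrable (column_law m n) (\<lambda>z. \<Prod>i\<in>{1..m}. 1 - \<phi> i z)"
    and "emeasure (column_law m n \<Otimes>\<^sub>M lborel_on {1..m})
      {(z, y) \<in> space (column_law m n \<Otimes>\<^sub>M lborel_on {1..m}). \<forall>i\<in>{1..m}. \<phi> i z \<le> y i \<and> y i \<le> 1} =
    ennreal (\<integral>z. (\<Prod>i\<in>{1..m}. 1 - \<phi> i z) \<partial>column_law m n)"
proof -
  interpret prob_space "column_law m n" by (rule prob_space_column_law[OF m])
  have b: "AE z in column_law m n. 0 \<le> (\<Prod>i\<in>{1..m}. 1 - \<phi> i z) \<and> (\<Prod>i\<in>{1..m}. 1 - \<phi> i z) \<le> 1"
    using \<phi>01 by eventually_elim (auto intro!: prod_nonneg prod_le_1)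
  show int: "integrable (column_law m n) (\<lambda>z. \<Prod>i\<in>{1..m}. 1 - \<phi> i z)"
  proof (rule integrable_const_bound)
    show "AE z in column_law m n. norm (\<Prod>i\<in>{1..m}. 1 - \<phi> i z) \<le> 1" using b by eventually_elim auto
  qed (intro borel_measurable_prod borel_measurable_diff borel_measurable_const \<phi>)
  have "(\<integral>\<^sup>+z. (\<Prod>i\<in>{1..m}. ennreal (1 - \<phi> i z)) \<partial>column_law m n) =
      (\<integral>\<^sup>+z. ennreal (\<Prod>i\<in>{1..m}. 1 - \<phi> i z) \<partial>column_law m n)"
    by (rule nn_integral_cong_AE) (use \<phi>01 in \<open>eventually_elim, auto intro!: prod_ennreal\<close>)
  also have "\<dots> = ennreal (\<integral>z. (\<Prod>i\<in>{1..m}. 1 - \<phi> i z) \<partial>column_law m n)"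
    using b by (intro nn_integral_eq_integral int) auto
  finally show "emeasure (column_law m n \<Otimes>\<^sub>M lborel_on {1..m})
      {(z, y) \<in> space (column_law m n \<Otimes>\<^sub>M lborel_on {1..m}). \<forall>i\<in>{1..m}. \<phi> i z \<le> y i \<and> y i \<le> 1} =
    ennreal (\<integral>z. (\<Prod>i\<in>{1..m}. 1 - \<phi> i z) \<partial>column_law m n)"
    unfolding emeasure_above_graph[OF G] .
qed

lemma measurable_bary_law_entry: "i \<in> {1..m} \<Longrightarrow> (\<lambda>z. z i) \<in> borel_measurable (bary_law m)"
  using measurable_component_real[of i "{1..m}"] by simp

text \<open>The symmetry of the coordinates is hidden in \<open>bary\<close>, which singles out
  coordinate \<open>m\<close>; the tail formula holds for every \<open>i\<close>, so the mean is
  obtained by integrating the tail.\<close>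

lemma expectation_bary_law:
  assumes m: "m \<ge> 2" and i: "i \<in> {1..m}"
  shows "(\<integral>z. z i \<partial>bary_law m) = 1 / real m"
proof -
  interpret prob_space "bary_law m" using m by (intro prob_space_bary_law) simp
  have "(\<integral>\<^sup>+z. ennreal (z i) \<partial>bary_law m) =
      (\<integral>\<^sup>+z. (\<integral>\<^sup>+t. indicator {0..<1} t * indicator {..z i} t \<partial>lborel) \<partial>bary_law m)"
  proof (rule nn_integral_cong_AE)
    show "AE z in bary_law m. ennreal (z i) = (\<integral>\<^sup>+t. indicator {0..<1} t * indicator {..z i} t \<partial>lborel)"
      using AE_bary_law_interior[OF m]
    proof eventually_elim
      case (elim z)
      then have "z i < 1" using i by blast
      then have "(\<lambda>t. indicator {0..<1} t * indicator {..z i} t :: ennreal) = indicator {0..z i}"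
        by (auto simp: indicator_def fun_eq_iff)
      then show ?case using elim i by (simp add: less_imp_le)
    qed
  qed
  also have "\<dots> = (\<integral>\<^sup>+t. indicator {0..<1} t * emeasure (bary_law m) {z \<in> space (bary_law m). t \<le> z i} \<partial>lborel)"
    by (rule nn_integral_layer_cake) (auto intro: measurable_bary_law_entry[OF i, simplified])
  also have "\<dots> = (\<integral>\<^sup>+t. ennreal ((1 - t) ^ (m - 1)) * indicator {0..1} t \<partial>lborel)"
  proof (rule nn_integral_cong)
    fix t :: real
    show "indicator {0..<1} t * emeasure (bary_law m) {z \<in> space (bary_law m). t \<le> z i} =
        ennreal ((1 - t) ^ (m - 1)) * indicator {0..1} t"
      using m prob_bary_law_ge[OF _ i, of t]
      by (cases "t = 1") (auto simp: indicator_def emeasure_eq_measure power_0_left)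
  qed
  also have "\<dots> = ennreal (- ((1 - 1) ^ m / real m) - - ((1 - 0) ^ m / real m))"
  proof (rule nn_integral_FTC_Icc[where F = "\<lambda>t. - ((1 - t) ^ m / real m)"])
    fix t :: real
    have "((\<lambda>t. - ((1 - t) ^ m / real m)) has_real_derivative - (- (real m * (1 - t) ^ (m - 1)) / real m)) (at t)"
      by (rule DERIV_minus, rule DERIV_cdivide) (rule derivative_eq_intros refl | simp add: One_nat_def)+
    then show "((\<lambda>t. - ((1 - t) ^ m / real m)) has_real_derivative (1 - t) ^ (m - 1)) (at t)"
      using m by simp
  qed auto
  also have "\<dots> = ennreal (1 / real m)" using m by (simp add: power_0_left)
  finally have nn: "(\<integral>\<^sup>+z. ennreal (z i) \<partial>bary_law m) = ennreal (1 / real m)" .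
  have "(\<integral>z. z i \<partial>bary_law m) = enn2real (\<integral>\<^sup>+z. ennreal (z i) \<partial>bary_law m)"
    using i by (intro integral_eq_nn_integral measurable_bary_law_entry)
      (auto intro!: eventually_mono[OF AE_bary_law_interior[OF m]] less_imp_le)
  then show ?thesis by (simp add: nn)
qed

text \<open>The row means sum to 1 almost surely, so the product is compared with its value at the
  barycentre. The expected squared distance from it is at most 1/n, which the constant 4 of
  \<open>prod_one_minus_near_barycenter\<close> turns into the error 4/n.\<close>

lemma weak_region_bounds:
  assumes m: "m \<ge> 2" and n: "n \<ge> 1"
  shows "measure (column_law m n \<Otimes>\<^sub>M lborel_on {1..m}) (weak_region m n) \<le> (1 - 1 / real m) ^ m"
    and "(1 - 1 / real m) ^ m * (1 - 4 / real n) \<le>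
      measure (column_law m n \<Otimes>\<^sub>M lborel_on {1..m}) (weak_region m n)"
proof -
  interpret C: prob_space "column_law m n" using m by (intro prob_space_column_law) simp
  interpret D: prob_space "bary_law m" using m by (intro prob_space_bary_law) simp
  interpret PD: product_prob_space "\<lambda>_::nat. bary_law m" using m by (intro product_prob_space_bary_law) simp
  define s where "s i z = (\<Sum>j\<in>{1..n}. z j i) / real n" for i :: nat and z :: "nat \<Rightarrow> nat \<Rightarrow> real"
  have s_meas: "s i \<in> borel_measurable (column_law m n)" if "i \<in> {1..m}" for i
    unfolding s_def
    by (intro borel_measurable_divide borel_measurable_sum borel_measurable_const measurable_column_entry that)
  have s_AE: "AE z in column_law m n. (\<forall>i\<in>{1..m}. 0 \<le> s i z \<and> s i z \<le> 1) \<and> (\<Sum>i\<in>{1..m}. s i z) = 1"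
    using AE_column_law[OF m]
  proof eventually_elim
    case (elim z)
    have "0 \<le> s i z \<and> s i z \<le> 1" if "i \<in> {1..m}" for i
    proof -
      have "0 \<le> z j i \<and> z j i \<le> 1" if "j \<in> {1..n}" for j
        using elim that \<open>i \<in> {1..m}\<close> by (auto intro: less_imp_le)
      then have "(\<Sum>j\<in>{1..n}. z j i) \<le> (\<Sum>j\<in>{1..n}. 1)" "0 \<le> (\<Sum>j\<in>{1..n}. z j i)"
        by (intro sum_mono sum_nonneg; blast)+
      then show ?thesis using n by (simp add: s_def)
    qed
    moreover have "(\<Sum>i\<in>{1..m}. s i z) = (\<Sum>j\<in>{1..n}. \<Sum>i\<in>{1..m}. z j i) / real n"
      by (simp add: s_def sum_divide_distrib[symmetric] sum.swap[of _ "{1..m}"])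
    ultimately show ?case using elim n by auto
  qed
  have eq: "weak_region m n = {(z, y) \<in> space (column_law m n \<Otimes>\<^sub>M lborel_on {1..m}).
      \<forall>i\<in>{1..m}. s i z \<le> y i \<and> y i \<le> 1}"
    by (simp add: weak_region_def s_def)
  have s01: "AE z in column_law m n. \<forall>i\<in>{1..m}. 0 \<le> s i z \<and> s i z \<le> 1"
    using s_AE by eventually_elim auto
  note ms = measure_above_graph[OF _ sets_regions(1)[of m n, unfolded eq] s_meas s01]
  have W: "measure (column_law m n \<Otimes>\<^sub>M lborel_on {1..m}) (weak_region m n) =
      (\<integral>z. (\<Prod>i\<in>{1..m}. 1 - s i z) \<partial>column_law m n)"
  proof -
    have "0 \<le> (\<integral>z. (\<Prod>i\<in>{1..m}. 1 - s i z) \<partial>column_law m n)"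
      by (intro integral_nonneg_AE) (use s01 in \<open>eventually_elim, auto intro!: prod_nonneg\<close>)
    then show ?thesis using m ms(2) by (simp add: measure_def eq)
  qed
  have "(\<integral>z. (\<Prod>i\<in>{1..m}. 1 - s i z) \<partial>column_law m n) \<le> (\<integral>z. (1 - 1 / real m) ^ m \<partial>column_law m n)"
  proof (rule integral_mono_AE)
    show "AE z in column_law m n. (\<Prod>i\<in>{1..m}. 1 - s i z) \<le> (1 - 1 / real m) ^ m"
      using s_AE by eventually_elim (rule prod_one_minus_near_barycenter[OF m], auto)
  qed (use m ms(1) in auto)
  then show "measure (column_law m n \<Otimes>\<^sub>M lborel_on {1..m}) (weak_region m n) \<le> (1 - 1 / real m) ^ m"
    by (simp add: W C.prob_space del: space_column_law)

  define f where "f i w = w i - 1 / real m" for i :: nat and w :: "nat \<Rightarrow> real"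
  have f_meas: "f i \<in> borel_measurable (bary_law m)" if "i \<in> {1..m}" for i
    unfolding f_def by (intro borel_measurable_diff borel_measurable_const measurable_bary_law_entry that)
  have f_AE: "AE w in bary_law m. \<bar>f i w\<bar> \<le> 1" if "i \<in> {1..m}" for i
    using AE_bary_law_interior[OF m]
  proof eventually_elim
    case (elim w)
    then have "0 < w i" "w i < 1" using that by auto
    moreover have "0 \<le> 1 / real m" "1 / real m \<le> 1" using m by auto
    ultimately show ?case by (simp only: f_def abs_le_iff) linarith
  qed
  have f_int: "integrable (bary_law m) (f i)" if "i \<in> {1..m}" for i
    using f_AE[OF that] f_meas[OF that] by (intro D.integrable_const_bound) auto
  have f2_int: "integrable (bary_law m) (\<lambda>w. (f i w)\<^sup>2)" if "i \<in> {1..m}" for i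
  proof (rule D.integrable_const_bound)
    show "AE w in bary_law m. norm ((f i w)\<^sup>2) \<le> 1"
      using f_AE[OF that] by eventually_elim (simp add: abs_square_le_1)
  qed (use f_meas[OF that] in auto)
  have f_mean: "(\<integral>w. f i w \<partial>bary_law m) = 0" if "i \<in> {1..m}" for i
  proof -
    have "integrable (bary_law m) (\<lambda>w. f i w + 1 / real m)"
      by (intro Bochner_Integration.integrable_add f_int that) simp
    then have "integrable (bary_law m) (\<lambda>w. w i)" by (simp add: f_def)
    then show ?thesis
      unfolding f_def using expectation_bary_law[OF m that] by (simp add: D.prob_space del: space_bary_law)
  qed
  \<comment> \<open>The total variance of a column is bounded independently of \<open>m\<close>,
    since (w i)^2 \<le> w i and the \<open>w i\<close> sum to 1. This makes the error in the lower
    bound uniform in \<open>m\<close>.\<close>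
  have f_var: "(\<Sum>i\<in>{1..m}. \<integral>w. (f i w)\<^sup>2 \<partial>bary_law m) \<le> 1"
  proof -
    have "(\<Sum>i\<in>{1..m}. \<integral>w. (f i w)\<^sup>2 \<partial>bary_law m) = (\<integral>w. (\<Sum>i\<in>{1..m}. (f i w)\<^sup>2) \<partial>bary_law m)"
      using f2_int by (simp add: Bochner_Integration.integral_sum)
    also have "\<dots> \<le> (\<integral>w. 1 \<partial>bary_law m)"
    proof (rule integral_mono_AE)
      show "AE w in bary_law m. (\<Sum>i\<in>{1..m}. (f i w)\<^sup>2) \<le> 1"
        using AE_bary_law_interior[OF m]
      proof eventually_elim
        case (elim w)
        have "(\<Sum>i\<in>{1..m}. (f i w)\<^sup>2) = (\<Sum>i\<in>{1..m}. (w i)\<^sup>2 - 2 / real m * w i + (1 / real m)\<^sup>2)"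
          by (intro sum.cong refl) (simp add: f_def power2_eq_square algebra_simps)
        also have "\<dots> = (\<Sum>i\<in>{1..m}. (w i)\<^sup>2) - 2 / real m * (\<Sum>i\<in>{1..m}. w i) + real m * (1 / real m)\<^sup>2"
          by (simp add: sum.distrib sum_subtractf sum_distrib_left)
        also have "\<dots> = (\<Sum>i\<in>{1..m}. (w i)\<^sup>2) - 1 / real m"
          using elim m by (simp add: power2_eq_square field_simps)
        also have "\<dots> \<le> (\<Sum>i\<in>{1..m}. (w i)\<^sup>2)" using m by simp
        also have "\<dots> \<le> (\<Sum>i\<in>{1..m}. w i)"
        proof (rule sum_mono)
          fix i assume "i \<in> {1..m}"
          then have "w i * w i \<le> 1 * w i" using elim by (intro mult_right_mono) (auto intro: less_imp_le)
          then show "(w i)\<^sup>2 \<le> w i" by (simp add: power2_eq_square)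
        qed
        finally show ?case using elim by simp
      qed
    qed (use f2_int in auto)
    finally show ?thesis by (simp add: D.prob_space del: space_bary_law)
  qed
  have s_f: "(s i z - 1 / real m)\<^sup>2 = (\<Sum>j\<in>{1..n}. f i (z j))\<^sup>2 / (real n)\<^sup>2" for i z
  proof -
    have "s i z - 1 / real m = (\<Sum>j\<in>{1..n}. f i (z j)) / real n"
      using n by (simp add: s_def f_def sum_subtractf diff_divide_distrib)
    then show ?thesis by (simp add: power_divide)
  qed
  have s_sq_int: "integrable (column_law m n) (\<lambda>z. (s i z - 1 / real m)\<^sup>2)"
    and s_sq: "(\<integral>z. (s i z - 1 / real m)\<^sup>2 \<partial>column_law m n) = (\<integral>w. (f i w)\<^sup>2 \<partial>bary_law m) / real n"
    if "i \<in> {1..m}" for i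
  proof -
    note sm = PD.second_moment_sum[of "{1..n}" "f i", OF _ f_int f2_int f_mean, OF _ that that that]
    show "integrable (column_law m n) (\<lambda>z. (s i z - 1 / real m)\<^sup>2)"
      unfolding s_f column_law_def by (intro integrable_divide sm(1)) simp
    have "(\<integral>z. (s i z - 1 / real m)\<^sup>2 \<partial>column_law m n) =
        (\<integral>z. (\<Sum>j\<in>{1..n}. f i (z j))\<^sup>2 \<partial>column_law m n) / (real n)\<^sup>2"
      unfolding s_f by (rule integral_divide_zero)
    also have "\<dots> = (\<integral>w. (f i w)\<^sup>2 \<partial>bary_law m) / real n"
      unfolding column_law_def using n by (subst sm(2)) (simp_all add: power2_eq_square)
    finally show "(\<integral>z. (s i z - 1 / real m)\<^sup>2 \<partial>column_law m n) = (\<integral>w. (f i w)\<^sup>2 \<partial>bary_law m) / real n" .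
  qed
  let ?g = "\<lambda>z. (1 - 1 / real m) ^ m * (1 - 4 * (\<Sum>i\<in>{1..m}. (s i z - 1 / real m)\<^sup>2))"
  have g_int: "integrable (column_law m n) ?g"
    using s_sq_int by (intro integrable_mult_right Bochner_Integration.integrable_diff
        Bochner_Integration.integrable_sum) auto
  have "(1 - 1 / real m) ^ m * (1 - 4 / real n) \<le>
      (1 - 1 / real m) ^ m * (1 - 4 * ((\<Sum>i\<in>{1..m}. \<integral>w. (f i w)\<^sup>2 \<partial>bary_law m) / real n))"
    using m n f_var by (intro mult_left_mono diff_left_mono zero_le_power) (auto simp: field_simps)
  also have "\<dots> = (\<integral>z. ?g z \<partial>column_law m n)"
  proof -
    have "(\<integral>z. 1 - 4 * (\<Sum>i\<in>{1..m}. (s i z - 1 / real m)\<^sup>2) \<partial>column_law m n) =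
        (\<integral>z. 1 \<partial>column_law m n) - (\<integral>z. 4 * (\<Sum>i\<in>{1..m}. (s i z - 1 / real m)\<^sup>2) \<partial>column_law m n)"
      using s_sq_int by (intro Bochner_Integration.integral_diff Bochner_Integration.integrable_sum
          integrable_mult_right) auto
    also have "\<dots> = 1 - 4 * ((\<Sum>i\<in>{1..m}. \<integral>w. (f i w)\<^sup>2 \<partial>bary_law m) / real n)"
      using s_sq_int s_sq
      by (simp add: Bochner_Integration.integral_sum C.prob_space sum_divide_distrib del: space_column_law)
    finally show ?thesis by simp
  qed
  also have "\<dots> \<le> (\<integral>z. (\<Prod>i\<in>{1..m}. 1 - s i z) \<partial>column_law m n)"
  proof (rule integral_mono_AE)
    show "AE z in column_law m n. ?g z \<le> (\<Prod>i\<in>{1..m}. 1 - s i z)"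
      using s_AE by eventually_elim (rule prod_one_minus_near_barycenter[OF m], auto)
  qed (use m ms(1) g_int in auto)
  finally show "(1 - 1 / real m) ^ m * (1 - 4 / real n) \<le>
      measure (column_law m n \<Otimes>\<^sub>M lborel_on {1..m}) (weak_region m n)"
    by (simp add: W)
qed

section \<open>The strong relaxation\<close>

lemma sets_bary_law_box:
  assumes "\<And>i. i \<in> {1..m} \<Longrightarrow> Measurable.pred borel (Q i)"
  shows "{w \<in> space (bary_law m). \<forall>i\<in>{1..m}. Q i (w i)} \<in> sets (bary_law m)"
proof (rule sets.sets_Collect_finite_All)
  fix i assume i: "i \<in> {1..m}"
  have "{x. Q i x} \<in> sets borel" using assms[OF i] by simp
  from measurable_sets[OF measurable_bary_law_entry[OF i] this]
  show "{w \<in> space (bary_law m). Q i (w i)} \<in> sets (bary_law m)"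
    by (simp add: vimage_def Int_def conj_commute)
qed simp

lemma emeasure_column_law_power:
  assumes m: "m \<ge> 1" and B: "B \<in> sets (bary_law m)"
  shows "emeasure (column_law m n) {z \<in> space (column_law m n). \<forall>j\<in>{1..n}. z j \<in> B} =
    emeasure (bary_law m) B ^ n"
proof -
  interpret product_prob_space "\<lambda>_::nat. bary_law m" using m by (rule product_prob_space_bary_law)
  have "{z \<in> space (column_law m n). \<forall>j\<in>{1..n}. z j \<in> B} = Pi\<^sub>E {1..n} (\<lambda>_. B)"
  proof (intro subset_antisym subsetI)
    fix z assume z: "z \<in> Pi\<^sub>E {1..n} (\<lambda>_. B)"
    then have "z j \<in> space (bary_law m)" if "j \<in> {1..n}" for j
      using sets.sets_into_space[OF B] that by (meson PiE_mem subsetD)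
    with z show "z \<in> {z \<in> space (column_law m n). \<forall>j\<in>{1..n}. z j \<in> B}"
      by (simp add: column_law_def space_PiM PiE_iff del: space_column_law space_bary_law)
  qed (simp add: column_law_def space_PiM PiE_iff del: space_column_law space_bary_law)
  then show ?thesis using B by (simp add: column_law_def emeasure_PiM)
qed

text \<open>Here \<open>y\<close> is fixed first, the opposite order to
  \<open>emeasure_above_graph\<close>; the columns then satisfy the same constraint independently,
  which yields the power \<open>n\<close>. \<open>strong_region_upper\<close> and
  \<open>strong_region_lower_box\<close> start from this formula.\<close>

lemma emeasure_strong_region:
  assumes m: "m \<ge> 1"
  shows "emeasure (column_law m n \<Otimes>\<^sub>M lborel_on {1..m}) (strong_region m n) =
    (\<integral>\<^sup>+y. (if \<forall>i\<in>{1..m}. y i \<le> 1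
      then emeasure (bary_law m) {w \<in> space (bary_law m). \<forall>i\<in>{1..m}. w i \<le> y i} ^ n else 0)
      \<partial>lborel_on {1..m})"
proof -
  interpret C: prob_space "column_law m n" using m by (rule prob_space_column_law)
  interpret Y: sigma_finite_measure "lborel_on {1..m}" by (rule sigma_finite_lborel_on) simp
  interpret pair_sigma_finite "column_law m n" "lborel_on {1..m}" ..
  show ?thesis
    unfolding emeasure_pair_measure_alt2[OF sets_regions(2)]
  proof (rule nn_integral_cong)
    fix y assume y: "y \<in> space (lborel_on {1..m})"
    let ?B = "{w \<in> space (bary_law m). \<forall>i\<in>{1..m}. w i \<le> y i}"
    have B: "?B \<in> sets (bary_law m)" by (rule sets_bary_law_box) simp
    have "(\<lambda>z. (z, y)) -` strong_region m n =
        (if \<forall>i\<in>{1..m}. y i \<le> 1 then {z \<in> space (column_law m n). \<forall>j\<in>{1..n}. z j \<in> ?B} else {})"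
      using y by (auto simp: strong_region_def space_pair_measure)
    then show "emeasure (column_law m n) ((\<lambda>z. (z, y)) -` strong_region m n) =
        (if \<forall>i\<in>{1..m}. y i \<le> 1 then emeasure (bary_law m) ?B ^ n else 0)"
      using emeasure_column_law_power[OF m B] by simp
  qed
qed

definition column_max :: "nat \<Rightarrow> nat \<Rightarrow> (nat \<Rightarrow> nat \<Rightarrow> real) \<Rightarrow> real" where
  "column_max n i z = Max ((\<lambda>j. z j i) ` {1..n})"

lemma measurable_column_max [measurable]:
  assumes i: "i \<in> {1..m}" and n: "n \<ge> 1"
  shows "column_max n i \<in> borel_measurable (column_law m n)"
  unfolding column_max_def using i n by (intro borel_measurable_Max measurable_column_entry) auto

lemma strong_region_eq:
  assumes "n \<ge> 1"
  shows "strong_region m n = {(z, y) \<in> space (column_law m n \<Otimes>\<^sub>M lborel_on {1..m}).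
    \<forall>i\<in>{1..m}. column_max n i z \<le> y i \<and> y i \<le> 1}"
  using assms by (auto simp: strong_region_def column_max_def Max_le_iff)

lemma AE_column_max:
  assumes m: "m \<ge> 2" and n: "n \<ge> 1"
  shows "AE z in column_law m n. \<forall>i\<in>{1..m}. 0 < column_max n i z \<and> column_max n i z < 1"
  using AE_column_law[OF m]
proof eventually_elim
  case (elim z)
  then show ?case using n by (auto simp: column_max_def Max_gr_iff Max_less_iff)
qed

lemma emeasure_strong_region_finite:
  assumes m: "m \<ge> 2" and n: "n \<ge> 1"
  shows "emeasure (column_law m n \<Otimes>\<^sub>M lborel_on {1..m}) (strong_region m n) =
      ennreal (\<integral>z. (\<Prod>i\<in>{1..m}. 1 - column_max n i z) \<partial>column_law m n)"
    and "integrable (column_law m n) (\<lambda>z. \<Prod>i\<in>{1..m}. 1 - column_max n i z)"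
proof -
  have "AE z in column_law m n. \<forall>i\<in>{1..m}. 0 \<le> column_max n i z \<and> column_max n i z \<le> 1"
    using AE_column_max[OF m n] by eventually_elim (auto intro: less_imp_le)
  note ms = measure_above_graph[OF _ sets_regions(2)[of m n, unfolded strong_region_eq[OF n]]
      measurable_column_max[OF _ n] this]
  show "emeasure (column_law m n \<Otimes>\<^sub>M lborel_on {1..m}) (strong_region m n) =
      ennreal (\<integral>z. (\<Prod>i\<in>{1..m}. 1 - column_max n i z) \<partial>column_law m n)"
    unfolding strong_region_eq[OF n] using m by (intro ms(2)) auto
  show "integrable (column_law m n) (\<lambda>z. \<Prod>i\<in>{1..m}. 1 - column_max n i z)"
    using m by (intro ms(1)) auto
qed

lemma ennreal_measure_strong_region:
  assumes m: "m \<ge> 2" and n: "n \<ge> 1"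
  shows "ennreal (measure (column_law m n \<Otimes>\<^sub>M lborel_on {1..m}) (strong_region m n)) =
    emeasure (column_law m n \<Otimes>\<^sub>M lborel_on {1..m}) (strong_region m n)"
  using emeasure_strong_region_finite(1)[OF m n] by (simp add: measure_def)

text \<open>Negative dependence replaces the joint probability by a product over the coordinates,
  after which the integral over \<open>y\<close> splits into \<open>m\<close> equal one-dimensional
  ones.\<close>

lemma strong_region_upper:
  assumes m: "m \<ge> 2" and n: "n \<ge> 1"
  shows "measure (column_law m n \<Otimes>\<^sub>M lborel_on {1..m}) (strong_region m n) \<le>
    pow_primitive (m - 1) n 1 ^ m"
proof -
  interpret L: product_sigma_finite "\<lambda>_::nat. lborel :: real measure"
    by (rule product_sigma_finite_lborel)
  interpret D: prob_space "bary_law m" using m by (intro prob_space_bary_law) simp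
  \<comment> \<open>The bound \<open>1 - 1\<close> keeps the shape of
    \<open>nn_integral_pow_primitive\<close>, used with \<open>\<delta> = 1\<close>.\<close>
  let ?g = "\<lambda>t::real. ennreal ((1 - (1 - t) ^ (m - 1)) ^ n) * indicator {1 - 1..1} t"
  have pos: "0 \<le> pow_primitive (m - 1) n 1"
    using m by (simp add: pow_primitive_1 prod_nonneg)
  have "emeasure (column_law m n \<Otimes>\<^sub>M lborel_on {1..m}) (strong_region m n) =
    (\<integral>\<^sup>+y. (if \<forall>i\<in>{1..m}. y i \<le> 1
      then emeasure (bary_law m) {w \<in> space (bary_law m). \<forall>i\<in>{1..m}. w i \<le> y i} ^ n else 0)
      \<partial>lborel_on {1..m})"
    using m by (intro emeasure_strong_region) simp
  also have "\<dots> \<le> (\<integral>\<^sup>+y. (\<Prod>i\<in>{1..m}. ?g (y i)) \<partial>lborel_on {1..m})"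
  proof (rule nn_integral_mono)
    fix y :: "nat \<Rightarrow> real"
    let ?B = "{w \<in> space (bary_law m). \<forall>i\<in>{1..m}. w i \<le> y i}"
    show "(if \<forall>i\<in>{1..m}. y i \<le> 1 then emeasure (bary_law m) ?B ^ n else 0) \<le> (\<Prod>i\<in>{1..m}. ?g (y i))"
    proof (cases "\<forall>i\<in>{1..m}. 0 \<le> y i \<and> y i \<le> 1")
      case True
      have nn: "0 \<le> 1 - (1 - y i) ^ (m - 1)" if "i \<in> {1..m}" for i
        using True that by (auto intro!: power_le_one)
      have "D.prob ?B \<le> (\<Prod>i\<in>{1..m}. 1 - (1 - y i) ^ (m - 1))"
        using True by (intro bary_law_negative_orthant[OF m]) auto
      then have "D.prob ?B ^ n \<le> (\<Prod>i\<in>{1..m}. (1 - (1 - y i) ^ (m - 1)) ^ n)"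
        unfolding prod_power_distrib[symmetric] by (intro power_mono) auto
      then have "emeasure (bary_law m) ?B ^ n \<le> ennreal (\<Prod>i\<in>{1..m}. (1 - (1 - y i) ^ (m - 1)) ^ n)"
        by (simp add: D.emeasure_eq_measure ennreal_power ennreal_leI del: space_bary_law)
      also have "\<dots> = (\<Prod>i\<in>{1..m}. ?g (y i))"
        using True nn by (subst prod_ennreal[symmetric]) (auto intro!: prod.cong zero_le_power)
      finally show ?thesis using True by simp
    next
      case False
      \<comment> \<open>A negative \<open>y i\<close> makes the event null because the coordinates
        are almost surely positive; \<open>n \<ge> 1\<close> then keeps the power at 0.\<close>
      have zero: "emeasure (bary_law m) ?B = 0" if le: "\<forall>i\<in>{1..m}. y i \<le> 1"
      proof -
        obtain i where i: "i \<in> {1..m}" "y i < 0" using False le by (meson not_le)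
        have "AE w in bary_law m. w \<notin> ?B"
          using AE_bary_law_interior[OF m]
        proof eventually_elim
          case (elim w)
          then have "0 < w i" using i by blast
          then show ?case using i by force
        qed
        then have "emeasure (bary_law m) ?B = emeasure (bary_law m) {}"
          by (intro emeasure_eq_AE sets_bary_law_box) (auto elim!: eventually_mono)
        then show ?thesis by simp
      qed
      have pow: "(0::ennreal) ^ n = 0" using n by (simp add: power_0_left)
      show ?thesis
      proof (cases "\<forall>i\<in>{1..m}. y i \<le> 1")
        case True
        show ?thesis unfolding if_P[OF True] zero[OF True] pow by (rule zero_le)
      next
        case False
        show ?thesis unfolding if_not_P[OF False] by (rule zero_le)
      qed
    qed
  qed
  also have "\<dots> = (\<Prod>i\<in>{1..m}. \<integral>\<^sup>+t. ?g t \<partial>lborel)"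
    by (intro L.product_nn_integral_prod) auto
  also have "\<dots> = ennreal (pow_primitive (m - 1) n 1 ^ m)"
    using m pos by (subst nn_integral_pow_primitive) (auto simp: ennreal_power)
  finally show ?thesis
    using pos by (simp add: ennreal_measure_strong_region[OF m n, symmetric])
qed

text \<open>On the box of side \<open>\<delta>\<close> at the corner let x be the sum of the tails
  \<open>(1 - y i) ^ (m - 1)\<close>. The union bound 1 - x is at least exp (- 2 x^2) times the
  product used in the upper bound. The power \<open>n\<close> makes the loss exp (- 2 n x^2), and x
  is at most \<open>real m * \<delta> ^ (m - 1)\<close>.\<close>

lemma strong_region_lower_box:
  assumes m: "m \<ge> 2" and n: "n \<ge> 1" and \<delta>: "0 < \<delta>" "\<delta> \<le> 1" and small: "real m * \<delta> ^ (m - 1) \<le> 1 / 2"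
  shows "exp (- 2 * real n * (real m * \<delta> ^ (m - 1))\<^sup>2) * pow_primitive (m - 1) n \<delta> ^ m \<le>
    measure (column_law m n \<Otimes>\<^sub>M lborel_on {1..m}) (strong_region m n)"
proof -
  interpret L: product_sigma_finite "\<lambda>_::nat. lborel :: real measure"
    by (rule product_sigma_finite_lborel)
  interpret D: prob_space "bary_law m" using m by (intro prob_space_bary_law) simp
  define c where "c = exp (- 2 * real n * (real m * \<delta> ^ (m - 1))\<^sup>2)"
  let ?g = "\<lambda>t::real. ennreal ((1 - (1 - t) ^ (m - 1)) ^ n) * indicator {1 - \<delta>..1} t"
  have "ennreal c * ennreal (pow_primitive (m - 1) n \<delta>) ^ m =
      ennreal c * (\<Prod>i\<in>{1..m}. \<integral>\<^sup>+t. ?g t \<partial>lborel)"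
    using m \<delta> by (subst nn_integral_pow_primitive) auto
  also have "\<dots> = ennreal c * (\<integral>\<^sup>+y. (\<Prod>i\<in>{1..m}. ?g (y i)) \<partial>lborel_on {1..m})"
    by (subst L.product_nn_integral_prod) auto
  also have "\<dots> = (\<integral>\<^sup>+y. ennreal c * (\<Prod>i\<in>{1..m}. ?g (y i)) \<partial>lborel_on {1..m})"
  proof (rule nn_integral_cmult[symmetric])
    have "(\<lambda>y. ?g (y i)) \<in> borel_measurable (lborel_on {1..m})" if "i \<in> {1..m}" for i
      by (rule measurable_compose[OF measurable_y_entry[OF that]]) simp
    then show "(\<lambda>y. \<Prod>i\<in>{1..m}. ?g (y i)) \<in> borel_measurable (lborel_on {1..m})"
      by (intro borel_measurable_prod_ennreal)
  qed
  also have "\<dots> \<le> (\<integral>\<^sup>+y. (if \<forall>i\<in>{1..m}. y i \<le> 1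
      then emeasure (bary_law m) {w \<in> space (bary_law m). \<forall>i\<in>{1..m}. w i \<le> y i} ^ n else 0)
      \<partial>lborel_on {1..m})"
  proof (rule nn_integral_mono)
    fix y :: "nat \<Rightarrow> real"
    let ?B = "{w \<in> space (bary_law m). \<forall>i\<in>{1..m}. w i \<le> y i}"
    show "ennreal c * (\<Prod>i\<in>{1..m}. ?g (y i)) \<le>
        (if \<forall>i\<in>{1..m}. y i \<le> 1 then emeasure (bary_law m) ?B ^ n else 0)"
    proof (cases "\<forall>i\<in>{1..m}. 1 - \<delta> \<le> y i \<and> y i \<le> 1")
      case True
      define q where "q i = (1 - y i) ^ (m - 1)" for i
      have q: "0 \<le> q i \<and> q i \<le> \<delta> ^ (m - 1) \<and> q i \<le> 1" if "i \<in> {1..m}" for i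
      proof -
        have "1 - \<delta> \<le> y i" "y i \<le> 1" using True that by auto
        then show ?thesis using \<delta> by (auto simp: q_def intro!: power_mono power_le_one)
      qed
      define x where "x = (\<Sum>i\<in>{1..m}. q i)"
      have x: "0 \<le> x" "x \<le> real m * \<delta> ^ (m - 1)"
        using q sum_bounded_above[of "{1..m}" q "\<delta> ^ (m - 1)"] by (auto simp: x_def intro: sum_nonneg)
      \<comment> \<open>The factor 2 in the exponent and the bound 1/2 in \<open>small\<close> come
        from ln (1 - x) \<ge> - x - 2 x^2, valid for 0 \<le> x \<le> 1/2.\<close>
      have "x \<le> 1 / 2" using x small by linarith
      with x have "exp (- x - 2 * x\<^sup>2) \<le> exp (ln (1 - x))"
        by (subst exp_le_cancel_iff) (rule ln_one_minus_pos_lower_bound)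
      then have "exp (- 2 * x\<^sup>2) * exp (- x) \<le> 1 - x"
        using \<open>x \<le> 1 / 2\<close> by (simp add: exp_add[symmetric] algebra_simps)
      moreover have "exp (- 2 * (real m * \<delta> ^ (m - 1))\<^sup>2) \<le> exp (- 2 * x\<^sup>2)"
        using x by (simp add: power_mono)
      moreover have "(\<Prod>i\<in>{1..m}. 1 - q i) \<le> exp (- x)"
      proof -
        have "(\<Prod>i\<in>{1..m}. 1 - q i) \<le> (\<Prod>i\<in>{1..m}. exp (- q i))"
          using q exp_ge_add_one_self[of "- q _"] by (intro prod_mono) auto
        then show ?thesis by (simp add: x_def exp_sum[symmetric] sum_negf)
      qed
      moreover have "0 \<le> (\<Prod>i\<in>{1..m}. 1 - q i)" using q by (intro prod_nonneg) auto
      ultimately have "exp (- 2 * (real m * \<delta> ^ (m - 1))\<^sup>2) * (\<Prod>i\<in>{1..m}. 1 - q i) \<le> 1 - x"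
        by (meson exp_ge_zero mult_mono order_trans)
      also have "1 - x \<le> D.prob ?B"
        unfolding x_def q_def
      proof (rule bary_law_union_bound[OF m])
        fix i assume "i \<in> {1..m}"
        then have "1 - \<delta> \<le> y i" "y i \<le> 1" using True by auto
        then show "0 \<le> y i \<and> y i \<le> 1" using \<delta> by simp
      qed
      finally have "(exp (- 2 * (real m * \<delta> ^ (m - 1))\<^sup>2) * (\<Prod>i\<in>{1..m}. 1 - q i)) ^ n \<le> D.prob ?B ^ n"
        using q by (intro power_mono mult_nonneg_nonneg prod_nonneg) auto
      moreover have "(exp (- 2 * (real m * \<delta> ^ (m - 1))\<^sup>2)) ^ n = c"
        by (simp add: c_def exp_of_nat_mult[symmetric])
      ultimately have "c * (\<Prod>i\<in>{1..m}. (1 - q i) ^ n) \<le> D.prob ?B ^ n"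
        by (simp add: power_mult_distrib prod_power_distrib del: space_bary_law)
      then have "ennreal (c * (\<Prod>i\<in>{1..m}. (1 - q i) ^ n)) \<le> emeasure (bary_law m) ?B ^ n"
        by (simp add: D.emeasure_eq_measure ennreal_power ennreal_leI del: space_bary_law)
      moreover have "ennreal (c * (\<Prod>i\<in>{1..m}. (1 - q i) ^ n)) = ennreal c * (\<Prod>i\<in>{1..m}. ?g (y i))"
      proof -
        have "(\<Prod>i\<in>{1..m}. ?g (y i)) = (\<Prod>i\<in>{1..m}. ennreal ((1 - q i) ^ n))"
          using True by (intro prod.cong refl) (auto simp: q_def)
        also have "\<dots> = ennreal (\<Prod>i\<in>{1..m}. (1 - q i) ^ n)"
          using q by (intro prod_ennreal) (auto intro!: zero_le_power)
        finally show ?thesis by (simp add: ennreal_mult' c_def)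
      qed
      ultimately show ?thesis using True by simp
    next
      case False
      then have "(\<Prod>i\<in>{1..m}. ?g (y i)) = 0"
        by (intro prod_zero) (auto simp: indicator_def)
      then show ?thesis by (simp only: mult_zero_right zero_le)
    qed
  qed
  also have "\<dots> = ennreal (measure (column_law m n \<Otimes>\<^sub>M lborel_on {1..m}) (strong_region m n))"
    using m n by (simp add: ennreal_measure_strong_region emeasure_strong_region)
  finally have *: "ennreal c * ennreal (pow_primitive (m - 1) n \<delta>) ^ m \<le>
      ennreal (measure (column_law m n \<Otimes>\<^sub>M lborel_on {1..m}) (strong_region m n))" .
  have "0 \<le> pow_primitive (m - 1) n \<delta>"
  proof -
    have "pow_primitive (m - 1) n 0 \<le> pow_primitive (m - 1) n \<delta>"
    proof (rule DERIV_nonneg_imp_nondecreasing[where f = "pow_primitive (m - 1) n"])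
      fix x assume "0 \<le> x" "x \<le> \<delta>"
      then have "0 \<le> (1 - x ^ (m - 1)) ^ n" using \<delta> by (intro zero_le_power) (auto intro: power_le_one)
      then show "\<exists>y. (pow_primitive (m - 1) n has_real_derivative y) (at x) \<and> 0 \<le> y"
        using DERIV_pow_primitive[of "m - 1"] m by fastforce
    qed (use \<delta> in simp)
    then show ?thesis by simp
  qed
  with * show ?thesis
    by (simp add: c_def ennreal_power ennreal_mult'[symmetric])
qed

section \<open>The Jensen bound through the row maxima\<close>

lemma prob_column_max_ge:
  assumes m: "m \<ge> 2" and n: "n \<ge> 1" and i: "i \<in> {1..m}" and t: "0 \<le> t" "t < 1"
  shows "emeasure (column_law m n) {z \<in> space (column_law m n). t \<le> column_max n i z} =
    ennreal (1 - (1 - (1 - t) ^ (m - 1)) ^ n)"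
proof -
  interpret C: prob_space "column_law m n" using m by (intro prob_space_column_law) simp
  interpret D: prob_space "bary_law m" using m by (intro prob_space_bary_law) simp
  let ?B = "{w \<in> space (bary_law m). w i < t}" and ?A = "{z \<in> space (column_law m n). t \<le> column_max n i z}"
  have ge: "{w \<in> space (bary_law m). t \<le> w i} \<in> sets (bary_law m)"
    using i by (intro borel_measurable_le measurable_bary_law_entry) auto
  have B: "?B = space (bary_law m) - {w \<in> space (bary_law m). t \<le> w i}" by auto
  have sB: "?B \<in> sets (bary_law m)" unfolding B using ge by (rule sets.compl_sets)
  have pB: "D.prob ?B = 1 - (1 - t) ^ (m - 1)"
    unfolding B using D.prob_compl[OF ge] prob_bary_law_ge[OF _ i t] m by simp
  have A: "?A \<in> sets (column_law m n)"
    using i n by (intro borel_measurable_le measurable_column_max) auto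
  have "space (column_law m n) - ?A = {z \<in> space (column_law m n). \<forall>j\<in>{1..n}. z j \<in> ?B}"
  proof -
    have "\<not> t \<le> column_max n i z \<longleftrightarrow> (\<forall>j\<in>{1..n}. z j i < t)" for z
      using n by (simp add: column_max_def not_le)
    moreover have "z j \<in> space (bary_law m)" if "z \<in> space (column_law m n)" "j \<in> {1..n}" for z j
      using that by (simp add: column_law_def space_PiM PiE_iff del: space_column_law space_bary_law)
    ultimately show ?thesis by blast
  qed
  moreover have "0 \<le> 1 - (1 - t) ^ (m - 1)" using t by (auto intro: power_le_one)
  ultimately have "C.prob (space (column_law m n) - ?A) = (1 - (1 - t) ^ (m - 1)) ^ n"
    using emeasure_column_law_power[OF _ sB, of n] m pB
    by (simp add: C.emeasure_eq_measure D.emeasure_eq_measure ennreal_power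
        del: space_bary_law space_column_law)
  then have "C.prob ?A = 1 - (1 - (1 - t) ^ (m - 1)) ^ n"
    using C.prob_compl[OF A] by linarith
  then show ?thesis by (simp only: C.emeasure_eq_measure)
qed

text \<open>Since - ln (1 - M) is the integral of 1/(1 - t) over [0, M], the weighted layer-cake
  formula reduces the expectation to the tail of the maximum.\<close>

lemma nn_integral_ln_column_max:
  assumes m: "m \<ge> 2" and n: "n \<ge> 1" and i: "i \<in> {1..m}"
  shows "(\<integral>\<^sup>+z. ennreal (- ln (1 - column_max n i z)) \<partial>column_law m n) \<le>
    ennreal (harm n / real (m - 1))"
proof -
  interpret C: prob_space "column_law m n" using m by (intro prob_space_column_law) simp
  have "(\<integral>\<^sup>+z. ennreal (- ln (1 - column_max n i z)) \<partial>column_law m n) =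
      (\<integral>\<^sup>+z. (\<integral>\<^sup>+t. (ennreal (1 / (1 - t)) * indicator {0..<1} t) * indicator {..column_max n i z} t \<partial>lborel)
        \<partial>column_law m n)"
  proof (rule nn_integral_cong_AE)
    show "AE z in column_law m n. ennreal (- ln (1 - column_max n i z)) =
        (\<integral>\<^sup>+t. (ennreal (1 / (1 - t)) * indicator {0..<1} t) * indicator {..column_max n i z} t \<partial>lborel)"
      using AE_column_max[OF m n]
    proof eventually_elim
      case (elim z)
      define M where "M = column_max n i z"
      have M: "0 < M" "M < 1" using elim i by (auto simp: M_def)
      have "(\<integral>\<^sup>+t. (ennreal (1 / (1 - t)) * indicator {0..<1} t) * indicator {..M} t \<partial>lborel) =
          (\<integral>\<^sup>+t. ennreal (1 / (1 - t)) * indicator {0..M} t \<partial>lborel)"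
        using M by (intro nn_integral_cong) (auto simp: indicator_def)
      also have "\<dots> = ennreal (- ln (1 - M) - - ln (1 - 0))"
      proof (rule nn_integral_FTC_Icc[where F = "\<lambda>t. - ln (1 - t)"])
        fix t assume t: "t \<in> {0..M}"
        then show "((\<lambda>t. - ln (1 - t)) has_real_derivative 1 / (1 - t)) (at t)"
          using M by (auto intro!: derivative_eq_intros simp: divide_inverse)
        show "0 \<le> 1 / (1 - t)" using t M by simp
      qed (use M in auto)
      finally show ?case by (simp add: M_def)
    qed
  qed
  also have "\<dots> = (\<integral>\<^sup>+t. (ennreal (1 / (1 - t)) * indicator {0..<1} t) *
      emeasure (column_law m n) {z \<in> space (column_law m n). t \<le> column_max n i z} \<partial>lborel)"
    using i n by (intro C.nn_integral_layer_cake measurable_column_max) auto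
  also have "\<dots> = (\<integral>\<^sup>+t. ennreal (1 / (1 - t)) * indicator {0..<1} t *
      ennreal (1 - (1 - (1 - t) ^ (m - 1)) ^ n) \<partial>lborel)"
    using prob_column_max_ge[OF m n i] by (intro nn_integral_cong) (auto simp: indicator_def)
  also have "\<dots> \<le> ennreal (harm n / real (m - 1))"
    using m by (intro nn_integral_hazard) simp
  finally show ?thesis .
qed

text \<open>Jensen's inequality for the exponential function: \<open>- ln (1 - X)\<close> is exponentially
  distributed for each entry \<open>X\<close>, so its maximum over a row has the harmonic number as
  expectation.\<close>

lemma strong_region_lower_exp:
  assumes m: "m \<ge> 2" and n: "n \<ge> 1"
  shows "exp (- (real m / real (m - 1) * harm n)) \<le>
    measure (column_law m n \<Otimes>\<^sub>M lborel_on {1..m}) (strong_region m n)"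
proof -
  interpret C: prob_space "column_law m n" using m by (intro prob_space_column_law) simp
  define l where "l i z = - ln (1 - column_max n i z)" for i z
  define \<mu> where "\<mu> = real m / real (m - 1) * harm n"
  have l_meas: "l i \<in> borel_measurable (column_law m n)" if "i \<in> {1..m}" for i
  proof -
    have [measurable]: "column_max n i \<in> borel_measurable (column_law m n)"
      by (rule measurable_column_max[OF that n])
    show ?thesis unfolding l_def by measurable
  qed
  have l_nn: "AE z in column_law m n. 0 \<le> l i z" if "i \<in> {1..m}" for i
    using AE_column_max[OF m n]
  proof eventually_elim
    case (elim z)
    then have "0 < column_max n i z" "column_max n i z < 1" using that by auto
    then show ?case by (simp add: l_def)
  qed
  have l_int: "integrable (column_law m n) (l i)" if i: "i \<in> {1..m}" for i
  proof (rule integrableI_nonneg[OF l_meas[OF i] l_nn[OF i]])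
    show "(\<integral>\<^sup>+z. ennreal (l i z) \<partial>column_law m n) < \<infinity>"
      using nn_integral_ln_column_max[OF m n i] unfolding l_def by (rule le_less_trans) simp
  qed
  have l_exp: "(\<integral>z. l i z \<partial>column_law m n) \<le> harm n / real (m - 1)" if i: "i \<in> {1..m}" for i
  proof -
    have "ennreal (\<integral>z. l i z \<partial>column_law m n) \<le> ennreal (harm n / real (m - 1))"
      using nn_integral_ln_column_max[OF m n i] nn_integral_eq_integral[OF l_int[OF i] l_nn[OF i]]
      by (simp add: l_def)
    then show ?thesis by (subst (asm) ennreal_le_iff) (auto simp: harm_nonneg)
  qed
  \<comment> \<open>Jensen in tangent form: with s the sum of the \<open>l i z\<close>, exp (- s)
    \<ge> exp (- \<mu>) (1 + \<mu> - s). The right side is linear in s, and its integral is at least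
    \<open>exp (- \<mu>)\<close> because the expectation of s is at most
    \<open>\<mu>\<close>.\<close>
  have "exp (- \<mu>) * (1 + \<mu> - (\<Sum>i\<in>{1..m}. \<integral>z. l i z \<partial>column_law m n)) =
      (\<integral>z. exp (- \<mu>) * (1 + \<mu> - (\<Sum>i\<in>{1..m}. l i z)) \<partial>column_law m n)"
  proof -
    have "(\<integral>z. 1 + \<mu> - (\<Sum>i\<in>{1..m}. l i z) \<partial>column_law m n) =
        (\<integral>z. 1 + \<mu> \<partial>column_law m n) - (\<integral>z. (\<Sum>i\<in>{1..m}. l i z) \<partial>column_law m n)"
      using l_int by (intro Bochner_Integration.integral_diff Bochner_Integration.integrable_sum) auto
    also have "\<dots> = 1 + \<mu> - (\<Sum>i\<in>{1..m}. \<integral>z. l i z \<partial>column_law m n)"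
      using l_int
      by (subst Bochner_Integration.integral_sum) (auto simp: C.prob_space simp del: space_column_law)
    finally show ?thesis by simp
  qed
  also have "\<dots> \<le> (\<integral>z. (\<Prod>i\<in>{1..m}. 1 - column_max n i z) \<partial>column_law m n)"
  proof (rule integral_mono_AE)
    show "AE z in column_law m n. exp (- \<mu>) * (1 + \<mu> - (\<Sum>i\<in>{1..m}. l i z)) \<le>
        (\<Prod>i\<in>{1..m}. 1 - column_max n i z)"
      using AE_column_max[OF m n]
    proof eventually_elim
      case (elim z)
      have "exp (- \<mu>) * (1 + (\<mu> - (\<Sum>i\<in>{1..m}. l i z))) \<le> exp (- \<mu>) * exp (\<mu> - (\<Sum>i\<in>{1..m}. l i z))"
        by (intro mult_left_mono exp_ge_add_one_self) auto
      also have "\<dots> = (\<Prod>i\<in>{1..m}. exp (- l i z))"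
        by (simp add: exp_add[symmetric] exp_sum[symmetric] sum_negf)
      also have "\<dots> = (\<Prod>i\<in>{1..m}. 1 - column_max n i z)"
        using elim by (intro prod.cong refl) (auto simp: l_def)
      finally show ?case by (simp add: algebra_simps)
    qed
    show "integrable (column_law m n) (\<lambda>z. exp (- \<mu>) * (1 + \<mu> - (\<Sum>i\<in>{1..m}. l i z)))"
      using l_int by (intro integrable_mult_right Bochner_Integration.integrable_diff
          Bochner_Integration.integrable_sum) auto
  qed (rule emeasure_strong_region_finite(2)[OF m n])
  also have "\<dots> \<le> measure (column_law m n \<Otimes>\<^sub>M lborel_on {1..m}) (strong_region m n)"
  proof -
    have "ennreal (\<integral>z. (\<Prod>i\<in>{1..m}. 1 - column_max n i z) \<partial>column_law m n) \<le>
        ennreal (measure (column_law m n \<Otimes>\<^sub>M lborel_on {1..m}) (strong_region m n))"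
      using emeasure_strong_region_finite(1)[OF m n] ennreal_measure_strong_region[OF m n] by simp
    then show ?thesis by (subst (asm) ennreal_le_iff) auto
  qed
  finally have main: "exp (- \<mu>) * (1 + \<mu> - (\<Sum>i\<in>{1..m}. \<integral>z. l i z \<partial>column_law m n)) \<le>
      measure (column_law m n \<Otimes>\<^sub>M lborel_on {1..m}) (strong_region m n)" .
  have "(\<Sum>i\<in>{1..m}. \<integral>z. l i z \<partial>column_law m n) \<le> (\<Sum>i\<in>{1..m}. harm n / real (m - 1))"
    by (intro sum_mono l_exp)
  then have "exp (- \<mu>) * 1 \<le> exp (- \<mu>) * (1 + \<mu> - (\<Sum>i\<in>{1..m}. \<integral>z. l i z \<partial>column_law m n))"
    using m by (intro mult_left_mono) (auto simp: \<mu>_def of_nat_diff)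
  with main show ?thesis unfolding \<mu>_def[symmetric] by linarith
qed

section \<open>Asymptotics\<close>

lemma volume_ratio_upper:
  assumes m: "m \<ge> 2" and n: "n \<ge> 1"
  shows "volume_ratio m n \<le> (1 - 1 / real m) ^ m * exp (real m / real (m - 1) * harm n)"
proof -
  define V where "V = measure (column_law m n \<Otimes>\<^sub>M lborel_on {1..m}) (strong_region m n)"
  have V: "exp (- (real m / real (m - 1) * harm n)) \<le> V"
    unfolding V_def by (rule strong_region_lower_exp[OF m n])
  then have V0: "V > 0" by (rule less_le_trans[OF exp_gt_zero])
  have "volume_ratio m n \<le> (1 - 1 / real m) ^ m / V"
    using volume_ratio_eq[of m n] weak_region_bounds(1)[OF m n] m n V0
    by (simp add: V_def divide_right_mono)
  also have "\<dots> \<le> (1 - 1 / real m) ^ m / exp (- (real m / real (m - 1) * harm n))"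
    using V V0 m by (intro divide_left_mono mult_pos_pos zero_le_power) auto
  finally show ?thesis by (simp add: exp_minus divide_inverse)
qed

lemma sum_inverse_squares_le: "(\<Sum>k\<in>{1..n}. 1 / (real k)\<^sup>2) \<le> 2"
proof -
  \<comment> \<open>The sharper bound 2 - 1/n lets the induction close by telescoping 1/n - 1/(n +
    1).\<close>
  have "(\<Sum>k\<in>{1..n}. 1 / (real k)\<^sup>2) \<le> 2 - 1 / real n" if "n \<ge> 1"
    using that
  proof (induction n rule: nat_induct_at_least)
    case (Suc n)
    have "1 / (real (Suc n))\<^sup>2 \<le> 1 / (real n * real (Suc n))"
      using Suc.hyps by (intro divide_left_mono) (auto simp: power2_eq_square)
    also have "\<dots> = 1 / real n - 1 / real (Suc n)"
      using Suc.hyps by (simp add: field_simps)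
    finally show ?case using Suc.IH by simp
  qed simp
  then show ?thesis by (cases "n = 0") (auto intro: order_trans)
qed

text \<open>From ln (1 + x) \<ge> x - x^2 each factor is at most exp (- a/k + a^2/k^2). In the power
  \<open>m\<close> the main exponent is that of the Jensen bound, since m a = m/(m - 1), while the
  excess 2 m a^2 vanishes as \<open>m\<close> grows.\<close>

lemma pow_primitive_1_le_exp:
  assumes m: "m \<ge> 2"
  shows "pow_primitive (m - 1) n 1 ^ m \<le>
    exp (- (real m / real (m - 1) * harm n)) * exp (2 * real m / (real (m - 1))\<^sup>2)"
proof -
  define a where "a = 1 / real (m - 1)"
  have a: "0 < a" "a \<le> 1" using m by (auto simp: a_def)
  have "pow_primitive (m - 1) n 1 = (\<Prod>k\<in>{1..n}. real k / (real k + a))"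
    using m by (simp add: pow_primitive_1 a_def)
  also have "\<dots> \<le> (\<Prod>k\<in>{1..n}. exp (- (a / real k) + a\<^sup>2 * (1 / (real k)\<^sup>2)))"
  proof (rule prod_mono)
    fix k assume k: "k \<in> {1..n}"
    have "exp (a / real k - (a / real k)\<^sup>2) \<le> exp (ln (1 + a / real k))"
      using a k by (subst exp_le_cancel_iff) (intro ln_one_plus_pos_lower_bound, auto simp: field_simps)
    also have "\<dots> = (real k + a) / real k"
      using a k by (subst exp_ln) (auto simp: field_simps add_pos_nonneg)
    finally have "inverse ((real k + a) / real k) \<le> inverse (exp (a / real k - (a / real k)\<^sup>2))"
      by (intro le_imp_inverse_le) auto
    also have "\<dots> = exp (- (a / real k) + a\<^sup>2 * (1 / (real k)\<^sup>2))"
      by (simp add: exp_minus[symmetric] power_divide)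
    finally show "0 \<le> real k / (real k + a) \<and> real k / (real k + a) \<le> exp (- (a / real k) + a\<^sup>2 * (1 / (real k)\<^sup>2))"
      using a by simp
  qed
  also have "\<dots> = exp (- (a * harm n) + a\<^sup>2 * (\<Sum>k\<in>{1..n}. 1 / (real k)\<^sup>2))"
    by (simp add: exp_sum[symmetric] sum.distrib sum_subtractf sum_negf sum_distrib_left harm_def divide_inverse)
  also have "\<dots> \<le> exp (- (a * harm n) + a\<^sup>2 * 2)"
    using sum_inverse_squares_le[of n] by (simp add: mult_left_mono)
  finally have "pow_primitive (m - 1) n 1 ^ m \<le> exp (- (a * harm n) + a\<^sup>2 * 2) ^ m"
    using m by (intro power_mono) (auto simp: pow_primitive_1 intro!: prod_nonneg)
  also have "\<dots> = exp (- (real m / real (m - 1) * harm n)) * exp (2 * real m / (real (m - 1))\<^sup>2)"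
    by (simp add: exp_of_nat_mult[symmetric] exp_add[symmetric] a_def power_divide algebra_simps)
  finally show ?thesis .
qed

text \<open>\<open>n \<ge> 4\<close> keeps the lower bound for the weak volume nonnegative, so that
  enlarging the strong volume in the denominator only decreases the quotient.\<close>

lemma volume_ratio_lower:
  assumes m: "m \<ge> 2" and n: "n \<ge> 4"
  shows "(1 - 1 / real m) ^ m * (1 - 4 / real n) * exp (real m / real (m - 1) * harm n) *
    exp (- (2 * real m / (real (m - 1))\<^sup>2)) \<le> volume_ratio m n"
proof -
  define V where "V = measure (column_law m n \<Otimes>\<^sub>M lborel_on {1..m}) (strong_region m n)"
  have n1: "n \<ge> 1" using n by simp
  have V0: "V > 0"
    unfolding V_def by (rule less_le_trans[OF exp_gt_zero strong_region_lower_exp[OF m n1]])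
  have V: "V \<le> exp (- (real m / real (m - 1) * harm n)) * exp (2 * real m / (real (m - 1))\<^sup>2)"
    unfolding V_def by (rule order_trans[OF strong_region_upper[OF m n1] pow_primitive_1_le_exp[OF m]])
  have "(1 - 1 / real m) ^ m * (1 - 4 / real n) /
      (exp (- (real m / real (m - 1) * harm n)) * exp (2 * real m / (real (m - 1))\<^sup>2)) \<le>
      (1 - 1 / real m) ^ m * (1 - 4 / real n) / V"
    using V V0 m n by (intro divide_left_mono mult_pos_pos mult_nonneg_nonneg zero_le_power) auto
  also have "\<dots> \<le> volume_ratio m n"
    using volume_ratio_eq[of m n] weak_region_bounds(2)[OF m n1] m n1 V0
    by (simp add: V_def divide_right_mono)
  finally show ?thesis by (simp add: exp_minus divide_inverse mult_ac)
qed

text \<open>Treats (b) and (c) together, with L = 1/\<beta> and L = 0. The weak volume contributes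
  exp (- 1); in the strong one (1 + a) H_n - ln n tends to \<gamma> + L, because a H_n has the same
  limit as ln n / m.\<close>

lemma volume_ratio_growing:
  fixes m :: "nat \<Rightarrow> nat"
  assumes m2: "\<And>n. n \<ge> 1 \<Longrightarrow> m n \<ge> 2"
    and m_top: "filterlim (\<lambda>n. real (m n)) at_top sequentially"
    and L: "(\<lambda>n. ln (real n) / real (m n)) \<longlonglongrightarrow> L"
  shows "(\<lambda>n. volume_ratio (m n) n) \<sim>[at_top] (\<lambda>n. exp (euler_mascheroni - 1 + L) * real n)"
proof -
  define r where "r n = (1 - 1 / real (m n)) ^ m n" for n
  define E where "E n = exp (real (m n) / real (m n - 1) * harm n) / real n" for n
  define D where "D n = exp (- (2 * real (m n) / (real (m n - 1))\<^sup>2))" for n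
  have ev: "eventually (\<lambda>n. n \<ge> 4 \<and> m n \<ge> 2) sequentially"
    using eventually_ge_at_top[of 4] by eventually_elim (use m2 in auto)
  have inv0: "(\<lambda>n. inverse (real (m n))) \<longlonglongrightarrow> 0"
    using m_top by (rule tendsto_inverse_0_at_top)
  have q: "(\<lambda>n. real (m n) / real (m n - 1)) \<longlonglongrightarrow> 1"
  proof -
    have "(\<lambda>n. 1 / (1 - inverse (real (m n)))) \<longlonglongrightarrow> 1 / (1 - 0)"
      by (intro tendsto_intros inv0) simp
    moreover have "eventually (\<lambda>n. 1 / (1 - inverse (real (m n))) = real (m n) / real (m n - 1)) sequentially"
      using ev by eventually_elim (simp add: field_simps of_nat_diff)
    ultimately show ?thesis by (simp add: Lim_transform_eventually)
  qed
  have a0: "(\<lambda>n. 1 / real (m n - 1)) \<longlonglongrightarrow> 0"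
  proof -
    have "(\<lambda>n. inverse (real (m n)) * (real (m n) / real (m n - 1))) \<longlonglongrightarrow> 0 * 1"
      by (intro tendsto_intros inv0 q)
    moreover have "eventually (\<lambda>n. inverse (real (m n)) * (real (m n) / real (m n - 1)) = 1 / real (m n - 1)) sequentially"
      using ev by eventually_elim (auto simp: field_simps)
    ultimately show ?thesis by (simp add: Lim_transform_eventually)
  qed
  have r: "r \<longlonglongrightarrow> exp (- 1)"
  proof -
    have "filterlim m at_top sequentially"
      using m_top by (simp add: filterlim_sequentially_iff_filterlim_real)
    from filterlim_compose[OF tendsto_exp_limit_sequentially[of "- 1"] this]
    show ?thesis by (simp add: r_def[abs_def])
  qed
  have D: "D \<longlonglongrightarrow> 1"
  proof -
    have "(\<lambda>n. exp (- (2 * (real (m n) / real (m n - 1)) * (1 / real (m n - 1))))) \<longlonglongrightarrow> exp (- (2 * 1 * 0))"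
      by (intro tendsto_intros q a0)
    then show ?thesis by (simp add: D_def[abs_def] power2_eq_square)
  qed
  have E: "E \<longlonglongrightarrow> exp (euler_mascheroni + L)"
  proof -
    \<comment> \<open>Splitting H_n into \<open>?h n\<close> and ln n leaves convergent sequences
      only: the multiple \<open>?h n / (m n - 1)\<close> vanishes and the logarithm enters through
      \<open>L\<close>.\<close>
    let ?h = "\<lambda>n. harm n - ln (real n) :: real"
    have "(\<lambda>n. exp (?h n + (?h n * (1 / real (m n - 1)) + ln (real n) / real (m n) * (real (m n) / real (m n - 1)))))
        \<longlonglongrightarrow> exp (euler_mascheroni + (euler_mascheroni * 0 + L * 1))"
      by (intro tendsto_intros euler_mascheroni_LIMSEQ a0 L q)
    moreover have "eventually (\<lambda>n. exp (?h n + (?h n * (1 / real (m n - 1)) +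
        ln (real n) / real (m n) * (real (m n) / real (m n - 1)))) = E n) sequentially"
      using ev
    proof eventually_elim
      case (elim n)
      have "real (m n) / real (m n - 1) = 1 + 1 / real (m n - 1)"
        using elim by (simp add: field_simps of_nat_diff)
      then have E: "E n = exp ((1 + 1 / real (m n - 1)) * harm n - ln (real n))"
        using elim by (simp add: E_def exp_diff)
      have l: "ln (real n) / real (m n) * (real (m n) / real (m n - 1)) = ln (real n) * (1 / real (m n - 1))"
        using elim by simp
      have "?h n + (?h n * b + ln (real n) * b) = (1 + b) * harm n - ln (real n)" for b
        by (simp add: algebra_simps)
      then show ?case unfolding E l by (rule arg_cong)
    qed
    ultimately show ?thesis by (simp add: Lim_transform_eventually)
  qed
  have target: "exp (- 1) * exp (euler_mascheroni + L) = exp (euler_mascheroni - 1 + L)"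
    by (simp add: exp_add[symmetric])
  have up: "(\<lambda>n. r n * E n) \<longlonglongrightarrow> exp (euler_mascheroni - 1 + L)"
    using tendsto_mult[OF r E] by (simp add: target)
  have "(\<lambda>n. 1 - 4 / real n) \<longlonglongrightarrow> 1 - 0"
    by (intro tendsto_intros lim_const_over_n)
  then have lo: "(\<lambda>n. r n * (1 - 4 / real n) * E n * D n) \<longlonglongrightarrow> exp (euler_mascheroni - 1 + L)"
    using tendsto_mult[OF tendsto_mult[OF tendsto_mult[OF r] E] D, of "\<lambda>n. 1 - 4 / real n" 1]
    by (simp add: target)
  have "(\<lambda>n. volume_ratio (m n) n / real n) \<longlonglongrightarrow> exp (euler_mascheroni - 1 + L)"
  proof (rule tendsto_sandwich[OF _ _ lo up])
    show "\<forall>\<^sub>F n in sequentially. r n * (1 - 4 / real n) * E n * D n \<le> volume_ratio (m n) n / real n"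
      using ev
    proof eventually_elim
      case (elim n)
      then show ?case
        using divide_right_mono[OF volume_ratio_lower[of "m n" n], of "real n"]
        by (simp add: r_def E_def D_def)
    qed
    show "\<forall>\<^sub>F n in sequentially. volume_ratio (m n) n / real n \<le> r n * E n"
      using ev
    proof eventually_elim
      case (elim n)
      then show ?case
        using divide_right_mono[OF volume_ratio_upper[of "m n" n], of "real n"]
        by (simp add: r_def E_def)
    qed
  qed
  then have "(\<lambda>n. volume_ratio (m n) n / real n / exp (euler_mascheroni - 1 + L)) \<longlonglongrightarrow>
      exp (euler_mascheroni - 1 + L) / exp (euler_mascheroni - 1 + L)"
    by (intro tendsto_divide tendsto_const) auto
  then show ?thesis
    by (intro asymp_equivI') (simp add: mult.commute)
qed

section \<open>The regime of fixed \<open>m\<close>\<close>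

lemma powr_mult_pow_primitive_1_tendsto:
  assumes p: "p \<ge> 1"
  shows "(\<lambda>n. real n powr (1 / real p) * pow_primitive p n 1) \<longlonglongrightarrow> Gamma (1 + 1 / real p)"
proof -
  define a where "a = 1 / real p"
  have a: "a > 0" using p by (simp add: a_def)
  \<comment> \<open>\<open>Gamma_series a n\<close> is n^a n! divided by a (a + 1) ... (a + n); the
    factor \<open>a\<close> in front removes the term with index 0, which the product for
    \<open>pow_primitive p n 1\<close> does not contain.\<close>
  have "(\<lambda>n. a * Gamma_series a n) \<longlonglongrightarrow> a * Gamma a"
    by (intro tendsto_intros)
  moreover have "a * Gamma a = Gamma (1 + a)"
    using a Gamma_plus1[of a] by (simp add: add.commute nonpos_Ints_def not_le) 
  moreover have "eventually (\<lambda>n. a * Gamma_series a n = real n powr a * pow_primitive p n 1) sequentially"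
    using eventually_gt_at_top[of 0]
  proof eventually_elim
    case (elim n)
    have "pochhammer a (n + 1) = (\<Prod>k\<in>{0..n}. a + real k)"
      by (simp only: Suc_eq_plus1[symmetric] pochhammer_Suc_prod)
    also have "\<dots> = a * (\<Prod>k\<in>{1..n}. real k + a)"
      by (simp add: prod.atLeast_Suc_atMost One_nat_def add.commute)
    finally have poch: "pochhammer a (n + 1) = a * (\<Prod>k\<in>{1..n}. real k + a)" .
    have "pow_primitive p n 1 = fact n / (\<Prod>k\<in>{1..n}. real k + a)"
      using p by (simp add: pow_primitive_1 a_def[symmetric] prod_dividef fact_prod)
    then show ?case
      using elim a by (simp add: Gamma_series_def poch powr_def del: pochhammer_Suc)
  qed
  ultimately show ?thesis by (simp add: Lim_transform_eventually a_def)
qed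

text \<open>The strong volume times n^(m a) tends to Gamma (1 + a)^m, and the weak volume tends to
  (1 - 1/m)^m = (1 + a)^(-m). Their quotient has Gamma (2 + a)^m in the denominator, and 2 + a = (2
  m - 1)/(m - 1).\<close>

lemma volume_ratio_fixed:
  assumes m: "m \<ge> 2"
  shows "(\<lambda>n. volume_ratio m n) \<sim>[at_top]
    (\<lambda>n. real n powr (real m / (real m - 1)) / Gamma ((2 * real m - 1) / (real m - 1)) ^ m)"
proof -
  define p where "p = m - 1"
  define a where "a = 1 / real p"
  have p: "p \<ge> 1" "real p = real m - 1" using m by (auto simp: p_def of_nat_diff)
  have a: "0 < a" "a \<le> 1" using p(1) by (auto simp: a_def)
  define V where "V n = measure (column_law m n \<Otimes>\<^sub>M lborel_on {1..m}) (strong_region m n)" for n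
  define W where "W n = measure (column_law m n \<Otimes>\<^sub>M lborel_on {1..m}) (weak_region m n)" for n
  define N where "N n = real n powr a" for n
  \<comment> \<open>\<open>\<epsilon> n\<close> is the tail probability of one coordinate at the
    edge of the box. The exponent lies strictly between -1 and -1/2: n \<epsilon> tends to infinity,
    so the part outside the box is negligible, and n \<epsilon>^2 tends to 0, so the union bound is
    sharp inside.\<close>
  define \<epsilon> where "\<epsilon> n = real n powr (- 2 / 3)" for n
  define \<delta> where "\<delta> n = \<epsilon> n powr a" for n
  have G: "Gamma (1 + a) > 0" using a by (intro Gamma_real_pos) simp
  have I: "(\<lambda>n. N n * pow_primitive p n 1) \<longlonglongrightarrow> Gamma (1 + a)"
    using powr_mult_pow_primitive_1_tendsto[OF p(1)] by (simp add: N_def a_def)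
  have eps0: "\<epsilon> \<longlonglongrightarrow> 0"
    unfolding \<epsilon>_def by (rule tendsto_neg_powr[OF _ filterlim_real_sequentially]) simp
  have root_top: "filterlim (\<lambda>n. real n powr (1 / 3)) at_top sequentially"
  proof -
    have "filterlim (\<lambda>n. 1 / 3 * ln (real n)) at_top sequentially"
      by (rule filterlim_tendsto_pos_mult_at_top[OF tendsto_const _
            filterlim_compose[OF ln_at_top filterlim_real_sequentially]]) simp
    then have "filterlim (\<lambda>n. exp (1 / 3 * ln (real n))) at_top sequentially"
      by (rule filterlim_compose[OF exp_at_top])
    moreover have "eventually (\<lambda>n. exp (1 / 3 * ln (real n)) = real n powr (1 / 3)) sequentially"
      using eventually_gt_at_top[of 0] by eventually_elim (simp add: powr_def)
    ultimately show ?thesis by (rule filterlim_mono_eventually[OF _ order_refl order_refl])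
  qed
  \<comment> \<open>The threshold 1/(2 m) is the hypothesis \<open>small\<close> of
    \<open>strong_region_lower_box\<close>, since
    \<open>\<delta> n ^ p = \<epsilon> n\<close>.\<close>
  have ev: "eventually (\<lambda>n. n \<ge> 1 \<and> \<epsilon> n \<le> 1 / (2 * real m) \<and> 0 < \<epsilon> n \<and> \<epsilon> n \<le> 1) sequentially"
  proof -
    have "eventually (\<lambda>n. \<epsilon> n < 1 / (2 * real m)) sequentially"
      using order_tendstoD(2)[OF eps0, of "1 / (2 * real m)"] m by simp
    then show ?thesis
      using eventually_ge_at_top[of 1]
    proof eventually_elim
      case (elim n)
      have "1 / (2 * real m) \<le> 1" using m by simp
      with elim show ?case by (auto simp: \<epsilon>_def)
    qed
  qed
  have \<delta>: "0 < \<delta> n" "\<delta> n \<le> 1" "\<delta> n ^ p = \<epsilon> n" if "0 < \<epsilon> n" "\<epsilon> n \<le> 1" for n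
  proof -
    show "0 < \<delta> n" using that by (simp add: \<delta>_def)
    show "\<delta> n \<le> 1" using that a by (simp add: \<delta>_def powr_le1)
    have "\<delta> n ^ p = \<delta> n powr real p" using \<open>0 < \<delta> n\<close> by (simp add: powr_realpow)
    also have "\<dots> = \<epsilon> n" using that p(1) by (simp add: \<delta>_def powr_powr a_def)
    finally show "\<delta> n ^ p = \<epsilon> n" .
  qed
  have tail: "(\<lambda>n. N n * (1 - \<epsilon> n) ^ n) \<longlonglongrightarrow> 0"
  proof (rule tendsto_sandwich[OF _ _ tendsto_const])
    \<comment> \<open>With u = n^(1/3): \<open>N n\<close> is at most n = u^3 because a \<le> 1, and
      (1 - \<epsilon>)^n is at most exp (- n \<epsilon>) = exp (- u).\<close>
    show "(\<lambda>n. (real n powr (1 / 3)) ^ 3 / exp (real n powr (1 / 3))) \<longlonglongrightarrow> 0"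
      by (rule filterlim_compose[OF tendsto_power_div_exp_0 root_top])
    show "eventually (\<lambda>n. 0 \<le> N n * (1 - \<epsilon> n) ^ n) sequentially"
      using ev by eventually_elim (simp add: N_def)
    show "eventually (\<lambda>n. N n * (1 - \<epsilon> n) ^ n \<le> (real n powr (1 / 3)) ^ 3 / exp (real n powr (1 / 3))) sequentially"
      using ev
    proof eventually_elim
      case (elim n)
      then have n: "real n \<ge> 1" by simp
      have "N n \<le> real n powr 1" unfolding N_def using a n by (intro powr_mono) auto
      also have "\<dots> = (real n powr (1 / 3)) ^ 3" using n by (simp add: powr_power)
      finally have 1: "N n \<le> (real n powr (1 / 3)) ^ 3" .
      have "(1 - \<epsilon> n) ^ n \<le> exp (- \<epsilon> n) ^ n"
        using elim exp_ge_add_one_self[of "- \<epsilon> n"] by (intro power_mono) auto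
      also have "\<dots> = exp (- (real n * \<epsilon> n))" by (simp add: exp_of_nat_mult[symmetric])
      also have "real n * \<epsilon> n = real n powr (1 / 3)"
        using n powr_add[of "real n" 1 "- 2 / 3"] by (simp add: \<epsilon>_def)
      finally have 2: "(1 - \<epsilon> n) ^ n \<le> exp (- (real n powr (1 / 3)))" .
      have "N n * (1 - \<epsilon> n) ^ n \<le> (real n powr (1 / 3)) ^ 3 * exp (- (real n powr (1 / 3)))"
        by (rule mult_mono[OF 1 2]) (use elim in auto)
      then show ?case by (simp only: exp_minus divide_inverse)
    qed
  qed
  have c: "(\<lambda>n. exp (- 2 * real n * (real m * \<epsilon> n)\<^sup>2)) \<longlonglongrightarrow> 1"
  proof -
    have "(\<lambda>n. real n powr (- 1 / 3)) \<longlonglongrightarrow> 0"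
      by (rule tendsto_neg_powr[OF _ filterlim_real_sequentially]) simp
    then have "(\<lambda>n. exp (- (2 * (real m)\<^sup>2 * real n powr (- 1 / 3)))) \<longlonglongrightarrow> exp (- (2 * (real m)\<^sup>2 * 0))"
      by (intro tendsto_intros)
    moreover have "eventually (\<lambda>n. exp (- (2 * (real m)\<^sup>2 * real n powr (- 1 / 3))) =
        exp (- 2 * real n * (real m * \<epsilon> n)\<^sup>2)) sequentially"
      using eventually_ge_at_top[of 1]
    proof eventually_elim
      case (elim n)
      have "real n * (\<epsilon> n)\<^sup>2 = real n powr 1 * (real n powr (- 2 / 3) * real n powr (- 2 / 3))"
        using elim by (simp add: \<epsilon>_def power2_eq_square)
      also have "\<dots> = real n powr (1 + (- 2 / 3 + - 2 / 3))" by (simp only: powr_add)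
      also have "1 + (- 2 / 3 + - 2 / 3) = - 1 / (3::real)" by simp
      finally have eq: "real n * (\<epsilon> n)\<^sup>2 = real n powr (- 1 / 3)" .
      show ?case unfolding eq[symmetric] power_mult_distrib by (simp only: mult_minus_left mult_minus_right mult_ac)
    qed
    ultimately show ?thesis by (simp add: Lim_transform_eventually)
  qed
  have lo: "(\<lambda>n. exp (- 2 * real n * (real m * \<epsilon> n)\<^sup>2) * (N n * pow_primitive p n 1 - N n * (1 - \<epsilon> n) ^ n) ^ m)
      \<longlonglongrightarrow> 1 * (Gamma (1 + a) - 0) ^ m"
    by (intro tendsto_intros c I tail)
  have up: "(\<lambda>n. (N n * pow_primitive p n 1) ^ m) \<longlonglongrightarrow> Gamma (1 + a) ^ m"
    by (intro tendsto_intros I)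
  have V: "(\<lambda>n. N n ^ m * V n) \<longlonglongrightarrow> Gamma (1 + a) ^ m"
  proof (rule tendsto_sandwich[OF _ _ _ up])
    show "(\<lambda>n. exp (- 2 * real n * (real m * \<epsilon> n)\<^sup>2) * (N n * pow_primitive p n 1 - N n * (1 - \<epsilon> n) ^ n) ^ m)
        \<longlonglongrightarrow> Gamma (1 + a) ^ m"
      using lo by simp
    show "eventually (\<lambda>n. N n ^ m * V n \<le> (N n * pow_primitive p n 1) ^ m) sequentially"
      using ev
    proof eventually_elim
      case (elim n)
      then show ?case
        using strong_region_upper[OF m, of n]
        by (simp add: V_def N_def p_def power_mult_distrib mult_left_mono)
    qed
    \<comment> \<open>The limit \<open>Gamma (1 + a)\<close> is positive, so the difference is
      eventually positive and the lower bound may be raised to the power \<open>m\<close>.\<close>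
    have "(\<lambda>n. N n * pow_primitive p n 1 - N n * (1 - \<epsilon> n) ^ n) \<longlonglongrightarrow> Gamma (1 + a) - 0"
      by (intro tendsto_intros I tail)
    then have "eventually (\<lambda>n. 0 < N n * pow_primitive p n 1 - N n * (1 - \<epsilon> n) ^ n) sequentially"
      using G by (intro order_tendstoD(1)) auto
    then show "eventually (\<lambda>n. exp (- 2 * real n * (real m * \<epsilon> n)\<^sup>2) *
        (N n * pow_primitive p n 1 - N n * (1 - \<epsilon> n) ^ n) ^ m \<le> N n ^ m * V n) sequentially"
      using ev
    proof eventually_elim
      case (elim n)
      have \<delta>1: "\<delta> n < 1"
      proof (rule ccontr)
        assume "\<not> \<delta> n < 1"
        then have "\<epsilon> n \<ge> 1" using \<delta>(3)[of n] elim one_le_power[of "\<delta> n" p] by simp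
        moreover have "1 / (2 * real m) < 1" using m by simp
        ultimately show False using elim by linarith
      qed
      have "pow_primitive p n 1 - (1 - \<epsilon> n) ^ n \<le> pow_primitive p n (\<delta> n)"
        using pow_primitive_ge[OF p(1), of "\<delta> n" n] \<delta>[of n] \<delta>1 elim by simp
      then have "N n * (pow_primitive p n 1 - (1 - \<epsilon> n) ^ n) \<le> N n * pow_primitive p n (\<delta> n)"
        by (intro mult_left_mono) (auto simp: N_def)
      then have "(N n * pow_primitive p n 1 - N n * (1 - \<epsilon> n) ^ n) ^ m \<le> (N n * pow_primitive p n (\<delta> n)) ^ m"
        using elim by (intro power_mono) (auto simp: right_diff_distrib)
      then have "exp (- 2 * real n * (real m * \<epsilon> n)\<^sup>2) *
          (N n * pow_primitive p n 1 - N n * (1 - \<epsilon> n) ^ n) ^ m \<le>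
          exp (- 2 * real n * (real m * \<epsilon> n)\<^sup>2) * (N n * pow_primitive p n (\<delta> n)) ^ m"
        by (intro mult_left_mono) auto
      also have "\<dots> = N n ^ m * (exp (- 2 * real n * (real m * \<epsilon> n)\<^sup>2) * pow_primitive p n (\<delta> n) ^ m)"
        by (simp add: power_mult_distrib)
      also have "\<dots> \<le> N n ^ m * V n"
      proof (rule mult_left_mono)
        have "real m * \<delta> n ^ (m - 1) \<le> 1 / 2"
          using \<delta>(3)[of n] elim m by (simp add: p_def[symmetric] field_simps)
        then show "exp (- 2 * real n * (real m * \<epsilon> n)\<^sup>2) * pow_primitive p n (\<delta> n) ^ m \<le> V n"
          using strong_region_lower_box[OF m, of n "\<delta> n"] \<delta>[of n] elim
          by (simp add: V_def p_def[symmetric])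
      qed (simp add: N_def)
      finally show ?case .
    qed
  qed
  have W: "W \<longlonglongrightarrow> (1 - 1 / real m) ^ m"
  proof (rule tendsto_sandwich[OF _ _ _ tendsto_const])
    have "(\<lambda>n. (1 - 1 / real m) ^ m * (1 - 4 / real n)) \<longlonglongrightarrow> (1 - 1 / real m) ^ m * (1 - 0)"
      by (intro tendsto_intros lim_const_over_n)
    then show "(\<lambda>n. (1 - 1 / real m) ^ m * (1 - 4 / real n)) \<longlonglongrightarrow> (1 - 1 / real m) ^ m" by simp
    show "eventually (\<lambda>n. (1 - 1 / real m) ^ m * (1 - 4 / real n) \<le> W n) sequentially"
      using eventually_ge_at_top[of 1] by eventually_elim (auto simp: W_def intro!: weak_region_bounds m)
    show "eventually (\<lambda>n. W n \<le> (1 - 1 / real m) ^ m) sequentially"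
      using eventually_ge_at_top[of 1] by eventually_elim (auto simp: W_def intro!: weak_region_bounds m)
  qed
  have "1 - 1 / real m = 1 / (1 + a)" using m p by (simp add: a_def field_simps)
  moreover have "Gamma ((2 * real m - 1) / (real m - 1)) = (1 + a) * Gamma (1 + a)"
  proof -
    have "(2 * real m - 1) / (real m - 1) = (1 + a) + 1"
      unfolding a_def p(2) using m by (simp add: field_simps)
    moreover have "1 + a \<notin> \<int>\<^sub>\<le>\<^sub>0" using a by (auto elim!: nonpos_Ints_cases)
    note Gamma_plus1[OF this]
    ultimately show ?thesis by (simp only:)
  qed
  ultimately have target: "(1 - 1 / real m) ^ m / Gamma (1 + a) ^ m * Gamma ((2 * real m - 1) / (real m - 1)) ^ m = 1"
    using less_imp_neq[OF G, symmetric] a by (simp add: power_mult_distrib power_divide)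
  have lim: "(\<lambda>n. W n / (N n ^ m * V n) * Gamma ((2 * real m - 1) / (real m - 1)) ^ m) \<longlonglongrightarrow>
      (1 - 1 / real m) ^ m / Gamma (1 + a) ^ m * Gamma ((2 * real m - 1) / (real m - 1)) ^ m"
    using G by (intro tendsto_intros W V) auto
  show ?thesis
  proof (rule asymp_equivI', rule Lim_transform_eventually[OF lim[unfolded target]])
    show "eventually (\<lambda>n. W n / (N n ^ m * V n) * Gamma ((2 * real m - 1) / (real m - 1)) ^ m =
        volume_ratio m n / (real n powr (real m / (real m - 1)) / Gamma ((2 * real m - 1) / (real m - 1)) ^ m)) sequentially"
      using eventually_ge_at_top[of 1]
    proof eventually_elim
      case (elim n)
      have "N n ^ m = real n powr (real m / (real m - 1))"
        using elim p by (simp add: N_def powr_power a_def)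
      then show ?case
        using volume_ratio_eq[of m n] m elim by (simp add: V_def W_def)
    qed
  qed
qed

theorem corollary13:
  shows "(\<forall>m::nat. m \<ge> 2 \<longrightarrow>
            (\<lambda>n. volume_ratio m n) \<sim>[at_top]
            (\<lambda>n. real n powr (real m / (real m - 1)) /
                  Gamma ((2 * real m - 1) / (real m - 1)) ^ m)) \<and>
         (\<forall>(m::nat \<Rightarrow> nat) (\<beta>::real).
            (\<forall>n\<ge>1. m n \<ge> 2) \<longrightarrow> \<beta> > 0 \<longrightarrow>
            (\<lambda>n. real (m n)) \<sim>[at_top] (\<lambda>n. \<beta> * ln (real n)) \<longrightarrow>
            (\<lambda>n. volume_ratio (m n) n) \<sim>[at_top]
            (\<lambda>n. exp (euler_mascheroni - 1 + 1 / \<beta>) * real n)) \<and>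
         (\<forall>m::nat \<Rightarrow> nat.
            (\<forall>n\<ge>1. m n \<ge> 2) \<longrightarrow>
            filterlim (\<lambda>n. real (m n) / ln (real n)) at_top at_top \<longrightarrow>
            (\<lambda>n. volume_ratio (m n) n) \<sim>[at_top]
            (\<lambda>n. exp (euler_mascheroni - 1) * real n))"
proof (intro conjI allI impI)
  have ln_top: "filterlim (\<lambda>n. ln (real n)) at_top sequentially"
    by (rule filterlim_compose[OF ln_at_top filterlim_real_sequentially])
  fix m :: "nat \<Rightarrow> nat" assume m2: "\<forall>n\<ge>1. m n \<ge> 2"
  {
    fix \<beta> :: real assume \<beta>: "\<beta> > 0" and equiv: "(\<lambda>n. real (m n)) \<sim>[at_top] (\<lambda>n. \<beta> * ln (real n))"
    have \<beta>_top: "filterlim (\<lambda>n. \<beta> * ln (real n)) at_top sequentially"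
      using \<beta> by (intro filterlim_tendsto_pos_mult_at_top[OF tendsto_const _ ln_top])
    have m_top: "filterlim (\<lambda>n. real (m n)) at_top sequentially"
      using asymp_equiv_at_top_transfer[OF asymp_equiv_symI[OF equiv] \<beta>_top] .
    have "(\<lambda>n. \<beta> * ln (real n) / real (m n)) \<longlonglongrightarrow> 1"
    proof (rule asymp_equivD_strong[OF asymp_equiv_symI[OF equiv]])
      \<comment> \<open>Asymptotic equivalence counts 0/0 as 1; the plain quotient converges because
        \<open>m n \<ge> 2\<close> rules out that case.\<close>
      show "\<forall>\<^sub>F n in sequentially. \<beta> * ln (real n) \<noteq> 0 \<or> real (m n) \<noteq> 0"
        using eventually_ge_at_top[of 1] by eventually_elim (use m2 in force)
    qed
    then have "(\<lambda>n. 1 / \<beta> * (\<beta> * ln (real n) / real (m n))) \<longlonglongrightarrow> 1 / \<beta> * 1"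
      by (intro tendsto_intros)
    then have "(\<lambda>n. ln (real n) / real (m n)) \<longlonglongrightarrow> 1 / \<beta>"
      using \<beta> by simp
    then show "(\<lambda>n. volume_ratio (m n) n) \<sim>[at_top] (\<lambda>n. exp (euler_mascheroni - 1 + 1 / \<beta>) * real n)"
      using m2 m_top by (intro volume_ratio_growing) auto
  }
  {
    assume top: "filterlim (\<lambda>n. real (m n) / ln (real n)) at_top at_top"
    have "filterlim (\<lambda>n. real (m n) / ln (real n) * ln (real n)) at_top sequentially"
      by (rule filterlim_at_top_mult_at_top[OF top ln_top])
    moreover have "eventually (\<lambda>n. real (m n) / ln (real n) * ln (real n) = real (m n)) sequentially"
      using eventually_gt_at_top[of 1] by eventually_elim simp
    ultimately have m_top: "filterlim (\<lambda>n. real (m n)) at_top sequentially"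
      by (rule filterlim_mono_eventually[OF _ order_refl order_refl])
    have "(\<lambda>n. ln (real n) / real (m n)) \<longlonglongrightarrow> 0"
      using tendsto_inverse_0_at_top[OF top] by simp
    then show "(\<lambda>n. volume_ratio (m n) n) \<sim>[at_top] (\<lambda>n. exp (euler_mascheroni - 1) * real n)"
      using m2 m_top volume_ratio_growing[of m 0] by simp
  }
qed (rule volume_ratio_fixed)

end
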